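(* Let $G$ be a character on $\mathbf{k}\langle\mathbf{a},\mathbf{b}\rangle$ and let $g$ be the associated chain map of the first kind. Then for all $\mathbf{ab}$-polynomials $u,v\in\mathbf{k}\langle\mathbf{a},\mathbf{b}\rangle$, $$g(N(u,v))=N(g(u),g(v)).$$
   Context: Let $\mathbf{k}$ be a field and $\mathbf{k}\langle\mathbf{a},\mathbf{b}\rangle$ the algebra of polynomials in noncommuting variables $\mathbf{a},\mathbf{b}$ of degree $1$. For a finite graded poset $P$ (with $\widehat 0$, $\widehat 1$, rank function $\rho$, $\rho(x,y)=\rho(y)-\rho(x)$) of rank at least $1$, the $\mathbf{ab}$-index is $\Psi(P)=\sum_c (\mathbf{a}-\mathbf{b})^{\rho(x_0,x_1)-1}\cdot\mathbf{b}\cdot(\mathbf{a}-\mathbf{b})^{\rho(x_1,x_2)-1}\cdot\mathbf{b}\cdots\mathbf{b}\cdot(\mathbf{a}-\mathbf{b})^{\rho(x_{k-1},x_k)-1}$, summed over all chains $c=\{\widehat 0=x_0<\cdots<x_k=\widehat 1\}$. The diamond product is $P\diamond Q=(P-\{\widehat 0\})\times(Q-\{\widehat 0\})\cup\{\widehat 0\}$, i.e. the Cartesian product of $P-\{\widehat 0_P\}$ and $Q-\{\widehat 0_Q\}$ with a new minimal element adjoined. The $\mathbf{ab}$-indices of graded posets span all $\mathbf{ab}$-polynomials, and by a known theorem there is a (unique) bilinear operator $N$ on $\mathbf{ab}$-polynomials such that $\Psi(P\diamond Q)=N(\Psi(P),\Psi(Q))$ for all graded posets $P,Q$ of rank at least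 $1$. A character $G$ on $\mathbf{k}\langle\mathbf{a},\mathbf{b}\rangle$ is a linear functional $G:\mathbf{k}\langle\mathbf{a},\mathbf{b}\rangle\to\mathbf{k}$ with $G(\Psi(P\times Q))=G(\Psi(P))\cdot G(\Psi(Q))$ for all graded posets $P,Q$ of rank at least $1$, where $P\times Q$ is the Cartesian product. Coproduct: for a monomial $u_1\cdots u_n$, $\Delta(u_1\cdots u_n)=\sum_{i=1}^n u_1\cdots u_{i-1}\otimes u_{i+1}\cdots u_n$ (so $\Delta(1)=0$), extended linearly; it is coassociative. $\Delta^1=\mathrm{id}$, $\Delta^{k+1}=(\mathrm{id}\otimes\Delta^k)\circ\Delta$, with Sweedler notation $\Delta^k(u)=\sum_u u_{(1)}\otimes\cdots\otimes u_{(k)}$. For homogeneous $u$ let $\widehat g(u)=G(u)(\mathbf{a}-\mathbf{b})^{\deg u}$ and $\kappa(u)=A(u)(\mathbf{a}-\mathbf{b})^{\deg u}$, extended linearly, where $A$ is the algebra map to $\mathbf{k}$ with $A(\mathbf{a})=1$, $A(\mathbf{b})=0$. The chain map of the first kind is $g(u)=\sum_{k\ge1}\sum_u\kappa(u_{(1)})\cdot\mathbf{b}\cdot\widehat g(u_{(2)})\cdot\mathbf{b}\cdots\mathbf{b}\cdot\widehat g(u_{(k)})$ (coproduct into $k$ parts). *)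

theory Defs
  imports Complex_Main "HOL-Library.Poly_Mapping"
begin

section \<open>Free associative algebras\<close>

text \<open>
  The free monoid on a set of letters, written additively because the convolution product of
  \<^typ>\<open>'m \<Rightarrow>\<^sub>0 'k\<close> is defined for additive monoids of exponents. Lists are wrapped in a new type
  so as not to equip \<^typ>\<open>'x list\<close> itself with an addition.
\<close>

datatype 'x word = Word (letters: "'x list")

instantiation word :: (type) monoid_add
begin

definition zero_word :: "'a word" where
  "0 = Word []"

definition plus_word :: "'a word \<Rightarrow> 'a word \<Rightarrow> 'a word" where
  "v + w = Word (letters v @ letters w)"

instance
  by standard (simp_all add: zero_word_def plus_word_def)

end

datatype ab_letter = LA | LB

type_synonym ab_word = "ab_letter word"

type_synonym 'k ab_poly = "ab_word \<Rightarrow>\<^sub>0 'k"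

text \<open>
  The algebra of tensors over the ab-polynomials: since the words are a basis of the
  ab-polynomials, the k-th tensor power has the sequences of k words as a basis, and the product
  in the free algebra on the set of words is the tensor product (concatenation of tensors).
\<close>

type_synonym 'k ab_tensor = "ab_word word \<Rightarrow>\<^sub>0 'k"

definition var_a :: "'k::field ab_poly" where
  "var_a = Poly_Mapping.single (Word [LA]) 1"

definition var_b :: "'k::field ab_poly" where
  "var_b = Poly_Mapping.single (Word [LB]) 1"

definition scale :: "'k::field \<Rightarrow> ('i \<Rightarrow>\<^sub>0 'k) \<Rightarrow> 'i \<Rightarrow>\<^sub>0 'k" where
  "scale c = Poly_Mapping.map ((*) c)"

text \<open>The linear extension of a map given on the basis elements.\<close>

definition lin_ext :: "('i \<Rightarrow> 'j \<Rightarrow>\<^sub>0 'k) \<Rightarrow> ('i \<Rightarrow>\<^sub>0 'k::field) \<Rightarrow> 'j \<Rightarrow>\<^sub>0 'k" where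
  "lin_ext f u = (\<Sum>i\<in>Poly_Mapping.keys u. scale (Poly_Mapping.lookup u i) (f i))"

definition bilinear_op :: "('k::field ab_poly \<Rightarrow> 'k ab_poly \<Rightarrow> 'k ab_poly) \<Rightarrow> bool" where
  "bilinear_op N \<longleftrightarrow>
     (\<forall>u. Vector_Spaces.linear scale scale (\<lambda>v. N u v)) \<and>
     (\<forall>v. Vector_Spaces.linear scale scale (\<lambda>u. N u v))"


section \<open>Graded posets\<close>

text \<open>
  A poset is given by its reflexive order relation; its underlying set is the field of the
  relation.
\<close>

definition is_bottom :: "'a rel \<Rightarrow> 'a \<Rightarrow> bool" where
  "is_bottom P z \<longleftrightarrow> z \<in> Field P \<and> (\<forall>x\<in>Field P. (z, x) \<in> P)"

definition is_top :: "'a rel \<Rightarrow> 'a \<Rightarrow> bool" where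
  "is_top P z \<longleftrightarrow> z \<in> Field P \<and> (\<forall>x\<in>Field P. (x, z) \<in> P)"

definition bottom_of :: "'a rel \<Rightarrow> 'a" where
  "bottom_of P = (THE z. is_bottom P z)"

definition top_of :: "'a rel \<Rightarrow> 'a" where
  "top_of P = (THE z. is_top P z)"

definition covered_by :: "'a rel \<Rightarrow> 'a \<Rightarrow> 'a \<Rightarrow> bool" where
  "covered_by P x y \<longleftrightarrow> (x, y) \<in> P - Id \<and> (\<nexists>z. (x, z) \<in> P - Id \<and> (z, y) \<in> P - Id)"

definition rank_function :: "'a rel \<Rightarrow> ('a \<Rightarrow> nat) \<Rightarrow> bool" where
  "rank_function P \<rho> \<longleftrightarrow>
     \<rho> (bottom_of P) = 0 \<and> (\<forall>x y. covered_by P x y \<longrightarrow> \<rho> y = \<rho> x + 1)"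

definition graded_poset :: "'a rel \<Rightarrow> bool" where
  "graded_poset P \<longleftrightarrow>
     finite (Field P) \<and> Partial_order P \<and> (\<exists>z. is_bottom P z) \<and> (\<exists>z. is_top P z) \<and>
     (\<exists>\<rho>. rank_function P \<rho>)"

text \<open>On the elements of a graded poset all rank functions agree.\<close>

definition rank :: "'a rel \<Rightarrow> 'a \<Rightarrow> nat" where
  "rank P = (SOME \<rho>. rank_function P \<rho>)"

definition poset_rank :: "'a rel \<Rightarrow> nat" where
  "poset_rank P = rank P (top_of P)"

text \<open>The Cartesian product and the diamond product; in the latter, \<^const>\<open>None\<close> is the new minimal element.\<close>

definition poset_prod :: "'a rel \<Rightarrow> 'b rel \<Rightarrow> ('a \<times> 'b) rel" where
  "poset_prod P Q = {((x, y), (x', y')). (x, x') \<in> P \<and> (y, y') \<in> Q}"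

definition diamond_prod :: "'a rel \<Rightarrow> 'b rel \<Rightarrow> ('a \<times> 'b) option rel" where
  "diamond_prod P Q =
     (let C = (Field P - {bottom_of P}) \<times> (Field Q - {bottom_of Q})
      in {None} \<times> insert None (Some ` C) \<union>
         {(Some p, Some q) | p q. p \<in> C \<and> q \<in> C \<and> (p, q) \<in> poset_prod P Q})"


section \<open>The ab-index\<close>

text \<open>The chains from the bottom to the top element, listed increasingly.\<close>

definition chains_bot_top :: "'a rel \<Rightarrow> 'a list set" where
  "chains_bot_top P =
     {xs. xs \<noteq> [] \<and> set xs \<subseteq> Field P \<and> sorted_wrt (\<lambda>x y. (x, y) \<in> P - Id) xs \<and>
          hd xs = bottom_of P \<and> last xs = top_of P}"

text \<open>
  The last equation is only reached by the one-element chain of a poset of rank 0 or by the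
  empty list; the ab-index is only used for posets of rank at least 1.
\<close>

fun chain_weight :: "('a \<Rightarrow> nat) \<Rightarrow> 'a list \<Rightarrow> 'k::field ab_poly" where
  "chain_weight \<rho> [x, y] = (var_a - var_b) ^ (\<rho> y - \<rho> x - 1)"
| "chain_weight \<rho> (x # y # z # zs) =
     (var_a - var_b) ^ (\<rho> y - \<rho> x - 1) * var_b * chain_weight \<rho> (y # z # zs)"
| "chain_weight \<rho> _ = 1"

definition ab_index :: "'a rel \<Rightarrow> 'k::field ab_poly" where
  "ab_index P = (\<Sum>xs\<in>chains_bot_top P. chain_weight (rank P) xs)"

text \<open>
  Every finite poset is isomorphic to one whose elements are natural numbers, so quantifying
  over relations on \<^typ>\<open>nat\<close> quantifies over all graded posets up to isomorphism.
\<close>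

definition is_diamond_operator :: "('k::field ab_poly \<Rightarrow> 'k ab_poly \<Rightarrow> 'k ab_poly) \<Rightarrow> bool" where
  "is_diamond_operator N \<longleftrightarrow>
     bilinear_op N \<and>
     (\<forall>(P :: nat rel) (Q :: nat rel).
        graded_poset P \<and> graded_poset Q \<and> 1 \<le> poset_rank P \<and> 1 \<le> poset_rank Q \<longrightarrow>
        ab_index (diamond_prod P Q) = N (ab_index P) (ab_index Q))"

definition diamond_op :: "'k::field ab_poly \<Rightarrow> 'k ab_poly \<Rightarrow> 'k ab_poly" where
  "diamond_op = (THE N. is_diamond_operator N)"

definition ab_character :: "('k::field ab_poly \<Rightarrow> 'k) \<Rightarrow> bool" where
  "ab_character G \<longleftrightarrow>
     Vector_Spaces.linear scale (*) G \<and>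
     (\<forall>(P :: nat rel) (Q :: nat rel).
        graded_poset P \<and> graded_poset Q \<and> 1 \<le> poset_rank P \<and> 1 \<le> poset_rank Q \<longrightarrow>
        G (ab_index (poset_prod P Q)) = G (ab_index P) * G (ab_index Q))"


section \<open>The coproduct and chain maps of the first kind\<close>

definition coproduct :: "'k::field ab_poly \<Rightarrow> (ab_word \<times> ab_word) \<Rightarrow>\<^sub>0 'k" where
  "coproduct = lin_ext (\<lambda>w. \<Sum>i<length (letters w).
     Poly_Mapping.single (Word (take i (letters w)), Word (drop (Suc i) (letters w))) 1)"

text \<open>
  \<open>coproduct_pow k\<close> is the iterated coproduct into \<open>k\<close> parts, for \<open>k \<ge> 1\<close>; the value at 0 is a
  dummy. In the last equation, \<open>coproduct_pow (Suc k)\<close> is applied to the second tensor factor.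
\<close>

fun coproduct_pow :: "nat \<Rightarrow> 'k::field ab_poly \<Rightarrow> 'k ab_tensor" where
  "coproduct_pow 0 u = 0"
| "coproduct_pow (Suc 0) u = lin_ext (\<lambda>w. Poly_Mapping.single (Word [w]) 1) u"
| "coproduct_pow (Suc (Suc k)) u =
     lin_ext (\<lambda>(v, w). Poly_Mapping.single (Word [v]) 1 *
                        coproduct_pow (Suc k) (Poly_Mapping.single w 1)) (coproduct u)"

text \<open>The algebra map to the field with \<open>a \<mapsto> 1\<close> and \<open>b \<mapsto> 0\<close>.\<close>

definition alg_map_A :: "'k::field ab_poly \<Rightarrow> 'k" where
  "alg_map_A u = (\<Sum>w\<in>Poly_Mapping.keys u. Poly_Mapping.lookup u w *
     prod_list (map (\<lambda>l. case l of LA \<Rightarrow> 1 | LB \<Rightarrow> 0) (letters w)))"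

text \<open>
  For a linear functional \<open>F\<close>, the linear map \<open>u \<mapsto> F(u) (a - b)^(deg u)\<close> for homogeneous \<open>u\<close>,
  extended linearly.
\<close>

definition hat :: "('k::field ab_poly \<Rightarrow> 'k) \<Rightarrow> 'k ab_poly \<Rightarrow> 'k ab_poly" where
  "hat F = lin_ext (\<lambda>w. scale (F (Poly_Mapping.single w 1)) ((var_a - var_b) ^ length (letters w)))"

definition kappa :: "'k::field ab_poly \<Rightarrow> 'k ab_poly" where
  "kappa = hat alg_map_A"

text \<open>
  The summand for a tensor \<open>w1 \<otimes> \<dots> \<otimes> wk\<close> of words is
  \<open>kappa w1 * b * hat G w2 * b * \<dots> * b * hat G wk\<close>.
\<close>

definition chain_map_term :: "('k::field ab_poly \<Rightarrow> 'k) \<Rightarrow> 'k ab_tensor \<Rightarrow> 'k ab_poly" where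
  "chain_map_term G = lin_ext (\<lambda>ws.
     kappa (Poly_Mapping.single (hd (letters ws)) 1) *
     prod_list (map (\<lambda>w. var_b * hat G (Poly_Mapping.single w 1)) (tl (letters ws))))"

text \<open>
  The sum over all \<open>k \<ge> 1\<close> is finite: the iterated coproduct into \<open>k\<close> parts vanishes on \<open>u\<close> as
  soon as \<open>k\<close> exceeds the degree of \<open>u\<close> by more than one.
\<close>

definition chain_map_first :: "('k::field ab_poly \<Rightarrow> 'k) \<Rightarrow> 'k ab_poly \<Rightarrow> 'k ab_poly" where
  "chain_map_first G u =
     (\<Sum>k | 1 \<le> k \<and> coproduct_pow k u \<noteq> 0. chain_map_term G (coproduct_pow k u))"

end

theory Submission
  imports Defs
begin

text \<open>
  Write \<open>e = a - b\<close>. Every poset enters the ab-index only through words in \<open>e\<close> and \<open>b\<close>: a chain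
  contributes \<open>e^(r1-1) b e^(r2-1) b \<dots>\<close>, where the \<open>ri\<close> are its rank jumps. After multiplication by
  \<open>b\<close> from the left such words are the monomial quasi-symmetric functions, the Cartesian
  product of posets becomes the quasi-shuffle product and the coproduct becomes deconcatenation. In
  these terms the theorem amounts to the statement that a multiplicative functional induces a multiplicative
  endomorphism of the quasi-symmetric functions.

  The diamond operator is made explicit as the bilinear operator \<open>dia\<close> determined by
  \<open>1\<close> being neutral, by \<open>e\<close> pulling out on both sides, and by \<open>dia (b u) (b v) = b mix u v\<close> with
  \<open>mix u v = dia u (b v) + dia (b u) v + e dia u v\<close>; the three summands say whether the first
  step up in a product changes the first coordinate, the second, or both. Summing over chains
  from the top downwards gives \<open>mix\<close> for Cartesian products and \<open>dia\<close> for diamond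
  products (\<open>ab_index_poset_prod\<close>, \<open>ab_index_diamond_prod\<close>). Posets with complete relations between
  consecutive levels of one or two elements realize all products of the factors \<open>a\<close> and
  \<open>a + b\<close>, so the ab-indices span over every field (\<open>ab_index_induct\<close>). Hence \<open>dia\<close> is the
  unique diamond operator, and a character satisfies \<open>G (mix u v) = G u * G v\<close> for all polynomials.

  On the algebraic side, \<open>u \<mapsto> u \<otimes> 1 + \<Sum> u1 \<otimes> b u2\<close>, with \<open>u1 \<otimes> u2\<close> running over the coproduct, is
  multiplicative for \<open>dia\<close> in both factors (\<open>coact_dia\<close>). The chain map \<open>g\<close> fixes \<open>1\<close>,
  commutes with left multiplication by \<open>e\<close>, and sends \<open>b u\<close> to \<open>b \<Sum> hat G (u1) g(u2)\<close>, where
  \<open>u1 \<otimes> u2\<close> now runs over this coaction. Since \<open>hat G\<close> turns \<open>mix\<close> into a product with one extra factor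
  \<open>e\<close>, expanding \<open>g (dia (b u) (b v))\<close> by the coaction yields precisely the three summands
  of \<open>dia (g (b u)) (g (b v))\<close>; this is an induction on length (\<open>diamond_hom_from_coaction\<close>).
\<close>

section \<open>Linear algebra of ab-polynomials\<close>

abbreviation lin :: "(('i \<Rightarrow>\<^sub>0 'k::field) \<Rightarrow> ('j \<Rightarrow>\<^sub>0 'k)) \<Rightarrow> bool" where
  "lin \<equiv> Vector_Spaces.linear scale scale"

lemma lookup_scale [simp]: "Poly_Mapping.lookup (scale c u) i = c * Poly_Mapping.lookup u i"
  unfolding scale_def by transfer (simp add: when_def)

lemma scale_zero_left [simp]: "scale 0 u = 0"
  and scale_zero_right [simp]: "scale c 0 = 0"
  and scale_one [simp]: "scale 1 u = u"
  and scale_scale [simp]: "scale c (scale d u) = scale (c * d) u"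
  and scale_add_right: "scale c (u + v) = scale c u + scale c v"
  and scale_add_left: "scale (c + d) u = scale c u + scale d u"
  and scale_single [simp]: "scale c (Poly_Mapping.single i d) = Poly_Mapping.single i (c * d)"
  by (rule poly_mapping_eqI; simp add: lookup_add algebra_simps lookup_single when_def)+

lemma scale_diff_right: "scale c (u - v) = scale c u - scale c v"
  by (rule poly_mapping_eqI) (simp add: lookup_minus algebra_simps)

lemma vector_space_scale: "vector_space (scale :: 'k::field \<Rightarrow> ('i \<Rightarrow>\<^sub>0 'k) \<Rightarrow> _)"
  by unfold_locales (simp_all add: scale_add_right scale_add_left)

lemma scale_mult_left [simp]:
  "scale c u * v = scale c (u * v)" for u v :: "'m::monoid_add \<Rightarrow>\<^sub>0 'k::field"
  unfolding scale_def mult_map_scale_conv_mult by (simp add: mult.assoc)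

text \<open>The algebra is not commutative, but constants are central; this makes \<^const>\<open>scale\<close> pull out of right factors.\<close>

lemma single_0_mult_commute:
  "Poly_Mapping.single 0 c * u = u * Poly_Mapping.single 0 c"
  for u :: "'m::monoid_add \<Rightarrow>\<^sub>0 'k::field"
proof (induction u rule: update_induct)
  case const
  show ?case by simp
next
  case (update f a b)
  have "Poly_Mapping.update a b f = f + Poly_Mapping.single a b"
    using update by (intro poly_mapping_eqI)
      (auto simp: lookup_update lookup_add lookup_single in_keys_iff)
  then show ?case
    using update by (simp add: distrib_left distrib_right mult_single mult.commute)
qed

lemma scale_mult_right [simp]:
  "u * scale c v = scale c (u * v)" for u v :: "'m::monoid_add \<Rightarrow>\<^sub>0 'k::field"
  unfolding scale_def mult_map_scale_conv_mult
  by (metis mult.assoc single_0_mult_commute)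

lemma lin_iff:
  "lin f \<longleftrightarrow> (\<forall>u v. f (u + v) = f u + f v) \<and> (\<forall>c u. f (scale c u) = scale c (f u))"
  by (simp add: Vector_Spaces.linear_iff vector_space_scale)

lemma linI:
  assumes "\<And>u v. f (u + v) = f u + f v" "\<And>c u. f (scale c u) = scale c (f u)"
  shows "lin f"
  using assms by (simp add: lin_iff)

lemma lin_add: "lin f \<Longrightarrow> f (u + v) = f u + f v"
  and lin_scale: "lin f \<Longrightarrow> f (scale c u) = scale c (f u)"
  by (simp_all add: lin_iff)

lemma lin_zero: "lin f \<Longrightarrow> f 0 = 0"
  using lin_scale[of f 0 0] by simp

lemma lin_diff: "lin f \<Longrightarrow> f (u - v) = f u - f v"
  by (metis (no_types, lifting) diff_add_cancel eq_diff_eq lin_add)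

lemma lin_sum: "lin f \<Longrightarrow> f (\<Sum>i\<in>A. x i) = (\<Sum>i\<in>A. f (x i))"
  by (induction A rule: infinite_finite_induct) (simp_all add: lin_zero lin_add)

lemma scale_sum: "scale c (\<Sum>i\<in>A. x i) = (\<Sum>i\<in>A. scale c (x i))"
  by (induction A rule: infinite_finite_induct) (simp_all add: scale_add_right)

lemma lin_intros:
  "lin (\<lambda>x. 0)"
  "lin (\<lambda>x. x)"
  "lin f \<Longrightarrow> lin g \<Longrightarrow> lin (\<lambda>x. f x + g x)"
  "lin f \<Longrightarrow> lin g \<Longrightarrow> lin (\<lambda>x. f x - g x)"
  "lin f \<Longrightarrow> lin (\<lambda>x. scale c (f x))"
  by (auto simp: lin_iff scale_add_right scale_diff_right mult.commute)

lemma lin_mult: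
  fixes f :: "('i \<Rightarrow>\<^sub>0 'k::field) \<Rightarrow> ('m::monoid_add \<Rightarrow>\<^sub>0 'k)"
  shows "lin f \<Longrightarrow> lin (\<lambda>x. p * f x)" "lin f \<Longrightarrow> lin (\<lambda>x. f x * p)"
  by (auto simp: lin_iff distrib_left distrib_right)

lemma lin_sum_fun: "(\<And>i. i \<in> A \<Longrightarrow> lin (f i)) \<Longrightarrow> lin (\<lambda>x. \<Sum>i\<in>A. f i x)"
  by (induction A rule: infinite_finite_induct) (simp_all add: lin_intros)

lemma lin_compose: "lin f \<Longrightarrow> lin g \<Longrightarrow> lin (\<lambda>x. f (g x))"
  by (auto simp: lin_iff)

lemma lin_ext_superset:
  assumes "finite A" "Poly_Mapping.keys u \<subseteq> A"
  shows "lin_ext f u = (\<Sum>i\<in>A. scale (Poly_Mapping.lookup u i) (f i))"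
  unfolding lin_ext_def using assms
  by (intro sum.mono_neutral_left) (auto simp: in_keys_iff)

lemma lin_lin_ext: "lin (lin_ext f :: ('i \<Rightarrow>\<^sub>0 'k::field) \<Rightarrow> _)"
proof (rule linI)
  fix u v :: "'i \<Rightarrow>\<^sub>0 'k" and c :: 'k
  let ?A = "Poly_Mapping.keys u \<union> Poly_Mapping.keys v \<union> Poly_Mapping.keys (u + v)"
  show "lin_ext f (u + v) = lin_ext f u + lin_ext f v"
    by (subst (1 2 3) lin_ext_superset[where A = ?A])
      (auto simp: lookup_add scale_add_left sum.distrib)
  show "lin_ext f (scale c u) = scale c (lin_ext f u)"
    by (subst (1 2) lin_ext_superset[where A = "Poly_Mapping.keys u"])
      (auto simp: in_keys_iff scale_sum)
qed

lemma lin_ext_single [simp]: "lin_ext f (Poly_Mapping.single i 1) = f i"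
  by (subst lin_ext_superset[where A = "{i}"]) auto

lemma lin_ext_add_fun: "lin_ext (\<lambda>w. f w + g w) u = lin_ext f u + lin_ext g u"
  unfolding lin_ext_def by (simp add: scale_add_right sum.distrib)

lemma lin_ext_lin_family:
  assumes "\<And>w. lin (\<lambda>x. f x w)"
  shows "lin (\<lambda>x. lin_ext (f x) u)"
  using assms unfolding lin_ext_def by (intro lin_sum_fun lin_intros)

lemma lin_of_lin_ext:
  assumes "lin g"
  shows "g (lin_ext f u) = lin_ext (\<lambda>i. g (f i)) u"
  unfolding lin_ext_def by (simp add: lin_sum[OF assms] lin_scale[OF assms])


subsection \<open>Induction along bases and generators\<close>

lemma single_induct [case_names zero add scale single]:
  assumes "P 0" "\<And>u v. P u \<Longrightarrow> P v \<Longrightarrow> P (u + v)" "\<And>c u. P u \<Longrightarrow> P (scale c u)"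
    and "\<And>i. P (Poly_Mapping.single i 1)"
  shows "P (u :: 'i \<Rightarrow>\<^sub>0 'k::field)"
proof (induction u rule: update_induct)
  case const
  show ?case by (rule assms)
next
  case (update f i c)
  have "Poly_Mapping.update i c f = f + scale c (Poly_Mapping.single i 1)"
    using update by (intro poly_mapping_eqI)
      (auto simp: lookup_update lookup_add lookup_single in_keys_iff)
  then show ?case
    using update assms(2)[OF _ assms(3)[OF assms(4)[of i], of c]] by simp
qed

abbreviation e_poly :: "'k::field ab_poly" where
  "e_poly \<equiv> var_a - var_b"

definition monom :: "ab_letter list \<Rightarrow> 'k::field ab_poly" where
  "monom w = Poly_Mapping.single (Word w) 1"

lemma monom_Nil [simp]: "monom [] = 1"
  by (simp add: monom_def flip: zero_word_def)

lemma monom_append: "monom (v @ w) = monom v * monom w"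
  by (simp add: monom_def mult_single plus_word_def)

lemma monom_Cons: "monom (LA # w) = var_a * monom w" "monom (LB # w) = var_b * monom w"
  by (simp_all add: monom_def mult_single plus_word_def var_a_def var_b_def)

lemma monom_induct [case_names zero add scale monom]:
  assumes "P 0" "\<And>u v. P u \<Longrightarrow> P v \<Longrightarrow> P (u + v)" "\<And>c u. P u \<Longrightarrow> P (scale c u)"
    and monom: "\<And>w. P (monom w)"
  shows "P (u :: 'k::field ab_poly)"
proof (induction u rule: single_induct)
  case (single w)
  show ?case using monom[of "letters w"] by (simp add: monom_def)
qed (use assms in auto)

lemma lin_eq_on_monom:
  assumes "lin f" "lin g" "\<And>w. f (monom w) = g (monom w)"
  shows "f u = g u"
  by (induction u rule: monom_induct) (simp_all add: assms lin_zero lin_add lin_scale)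

text \<open>
  The products of \<open>p\<close> and \<open>q\<close> span as soon as the linear span of \<open>p\<close> and \<open>q\<close> contains both
  variables: in a word the letters can be exchanged one at a time for \<open>p\<close> and \<open>q\<close>. The auxiliary
  statement therefore carries a prefix of letters that are exchanged already.
\<close>

lemma product_induct:
  fixes p q :: "'k::field ab_poly"
  assumes "P 0" "\<And>u v. P u \<Longrightarrow> P v \<Longrightarrow> P (u + v)" "\<And>c u. P u \<Longrightarrow> P (scale c u)"
    and gen: "\<And>w. P (prod_list (map (case_ab_letter p q) w))"
    and ab: "var_a = scale a1 p + scale a2 q" "var_b = scale b1 p + scale b2 q"
  shows "P u"
proof -
  have "P (prod_list (map (case_ab_letter p q) w) * monom v)" for v w
  proof (induction v arbitrary: w)
    case Nil
    show ?case using gen by simp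
  next
    case (Cons l v)
    have "P (prod_list (map (case_ab_letter p q) w) * (p * monom v))"
      "P (prod_list (map (case_ab_letter p q) w) * (q * monom v))"
      using Cons[of "w @ [LA]"] Cons[of "w @ [LB]"] by (simp_all add: mult.assoc)
    then show ?case
      by (cases l) (auto simp: monom_Cons ab distrib_left distrib_right intro!: assms(2,3))
  qed
  from this[of "[]"] show ?thesis
    by (induction u rule: monom_induct) (auto intro: assms)
qed

definition lin_words :: "(ab_letter list \<Rightarrow> 'k ab_poly) \<Rightarrow> 'k::field ab_poly \<Rightarrow> 'k ab_poly" where
  "lin_words f = lin_ext (\<lambda>w. f (letters w))"

lemma lin_lin_words: "lin (lin_words f)"
  by (simp add: lin_words_def lin_lin_ext)

lemma lin_words_monom [simp]: "lin_words f (monom w) = f w"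
  by (simp add: lin_words_def monom_def)

lemma lin_lin_words_family: "(\<And>w. lin (\<lambda>x. f x w)) \<Longrightarrow> lin (\<lambda>x. lin_words (f x) u)"
  by (simp add: lin_words_def lin_ext_lin_family)

lemma eb_product_induct:
  fixes u :: "'k::field ab_poly"
  assumes "P 0" "\<And>u v. P u \<Longrightarrow> P v \<Longrightarrow> P (u + v)" "\<And>c u. P u \<Longrightarrow> P (scale c u)"
    and gen: "\<And>w. P (prod_list (map (case_ab_letter e_poly var_b) w))"
  shows "P u"
  by (rule product_induct[where P = P, OF assms, where ?a1.0 = 1 and ?a2.0 = 1
        and ?b1.0 = 0 and ?b2.0 = 1]) simp_all

lemma bilinear_op_iff: "bilinear_op B \<longleftrightarrow> (\<forall>x. lin (B x)) \<and> (\<forall>y. lin (\<lambda>x. B x y))"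
  by (auto simp: bilinear_op_def)

text \<open>
  The induction scheme that mirrors the recursion of the diamond operator. Its last case refers to
  the three pairs that occur in \<open>mix u v\<close>.
\<close>

lemma eb_induct2 [case_names add1 scale1 add2 scale2 one1 one2 e1 e2 bb]:
  fixes u v :: "'k::field ab_poly"
  assumes add1: "\<And>u u' v. P u v \<Longrightarrow> P u' v \<Longrightarrow> P (u + u') v"
    and scale1: "\<And>c u v. P u v \<Longrightarrow> P (scale c u) v"
    and add2: "\<And>u v v'. P u v \<Longrightarrow> P u v' \<Longrightarrow> P u (v + v')"
    and scale2: "\<And>c u v. P u v \<Longrightarrow> P u (scale c v)"
    and one: "\<And>v. P 1 v" "\<And>u. P u 1"
    and e: "\<And>u v. P u v \<Longrightarrow> P (e_poly * u) v" "\<And>u v. P u v \<Longrightarrow> P u (e_poly * v)"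
    and bb: "\<And>u v. P u (var_b * v) \<Longrightarrow> P (var_b * u) v \<Longrightarrow> P u v \<Longrightarrow> P (var_b * u) (var_b * v)"
  shows "P u v"
proof -
  let ?eb = "\<lambda>w. prod_list (map (case_ab_letter e_poly var_b) w) :: 'k ab_poly"
  have zero1: "P 0 v" for v using scale1[OF one(1), of 0] by simp
  have zero2: "P u 0" for u using scale2[OF one(2), of _ 0] by simp
  have "P (?eb x) (?eb y)" for x y
  proof (induction "length x + length y" arbitrary: x y rule: less_induct)
    case less
    show ?case
    proof (cases x)
      case Nil
      then show ?thesis using one by simp
    next
      case x: (Cons k x')
      show ?thesis
      proof (cases y)
        case Nil
        then show ?thesis using one by simp
      next
        case y: (Cons l y')
        show ?thesis
        proof (cases k)
          case LA
          then show ?thesis using e(1) less[of x' y] x by simp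
        next
          case k: LB
          show ?thesis
          proof (cases l)
            case LA
            then show ?thesis using e(2) less[of x y'] y by simp
          next
            case LB
            then show ?thesis
              using bb[of "?eb x'" "?eb y'"] less[of x' y] less[of x y'] less[of x' y'] x y k
              by simp
          qed
        qed
      qed
    qed
  qed
  then have "P u (?eb y)" for y
    by (induction u rule: eb_product_induct) (auto intro: add1 scale1 zero1)
  then show ?thesis
    by (induction v rule: eb_product_induct) (auto intro: add2 scale2 zero2)
qed

section \<open>The diamond operator and the mixing operator on polynomials\<close>

text \<open>
  The recursion is natural in \<open>e\<close> and \<open>b\<close>, but the basis at hand consists of words in \<open>a\<close> and
  \<open>b\<close>. A leading \<open>a\<close> is therefore replaced by \<open>e + b\<close>, which keeps the length of a word but lowers the
  number of its letters \<open>a\<close>; weighting \<open>a\<close> by 2 and \<open>b\<close> by 1 gives termination.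
\<close>

function dia_word :: "ab_letter list \<Rightarrow> ab_letter list \<Rightarrow> 'k::field ab_poly" where
  "dia_word [] y = monom y"
| "dia_word (LA # x) y = e_poly * dia_word x y + dia_word (LB # x) y"
| "dia_word (LB # x) [] = monom (LB # x)"
| "dia_word (LB # x) (LA # y) = e_poly * dia_word (LB # x) y + dia_word (LB # x) (LB # y)"
| "dia_word (LB # x) (LB # y) =
     var_b * (dia_word x (LB # y) + dia_word (LB # x) y + e_poly * dia_word x y)"
  by pat_completeness auto

termination
  by (relation "measure (\<lambda>(x, y). sum_list (map (case_ab_letter 2 1) (x @ y)))") auto

definition dia :: "'k::field ab_poly \<Rightarrow> 'k ab_poly \<Rightarrow> 'k ab_poly" where
  "dia u v = lin_words (\<lambda>x. lin_words (dia_word x) v) u"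

text \<open>
  The counterpart for Cartesian products. Up to a factor \<open>b\<close> on the left of each word it is the
  quasi-shuffle product.
\<close>

definition mix :: "'k::field ab_poly \<Rightarrow> 'k ab_poly \<Rightarrow> 'k ab_poly" where
  "mix u v = dia u (var_b * v) + dia (var_b * u) v + e_poly * dia u v"

lemma bilinear_dia: "bilinear_op dia"
  unfolding bilinear_op_iff dia_def
  by (intro conjI allI lin_lin_words_family lin_lin_words)

lemma lin_dia: "lin f \<Longrightarrow> lin (\<lambda>x. dia (f x) v)" "lin f \<Longrightarrow> lin (\<lambda>x. dia u (f x))"
  using bilinear_dia by (auto simp: bilinear_op_iff intro: lin_compose[where f = "dia u"]
      lin_compose[where f = "\<lambda>u. dia u v"])

lemmas lin_rules = lin_intros lin_mult lin_dia lin_lin_words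

lemma lin_mix: "lin f \<Longrightarrow> lin (\<lambda>x. mix (f x) v)" "lin f \<Longrightarrow> lin (\<lambda>x. mix u (f x))"
  unfolding mix_def by (intro lin_rules; assumption)+

lemmas dia_add = lin_add[OF lin_dia(1)[OF lin_intros(2)]] lin_add[OF lin_dia(2)[OF lin_intros(2)]]
lemmas dia_diff = lin_diff[OF lin_dia(1)[OF lin_intros(2)]] lin_diff[OF lin_dia(2)[OF lin_intros(2)]]
lemmas dia_scale = lin_scale[OF lin_dia(1)[OF lin_intros(2)]] lin_scale[OF lin_dia(2)[OF lin_intros(2)]]
lemmas dia_sum = lin_sum[OF lin_dia(1)[OF lin_intros(2)]] lin_sum[OF lin_dia(2)[OF lin_intros(2)]]
lemmas dia_zero = lin_zero[OF lin_dia(1)[OF lin_intros(2)]] lin_zero[OF lin_dia(2)[OF lin_intros(2)]]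

lemma dia_monom [simp]: "dia (monom x) (monom y) = dia_word x y"
  by (simp add: dia_def)

lemma bilinear_eq_on_monom:
  assumes "\<And>v. lin (\<lambda>u. f u v)" "\<And>u. lin (f u)" "\<And>v. lin (\<lambda>u. g u v)" "\<And>u. lin (g u)"
    and "\<And>x y. f (monom x) (monom y) = g (monom x) (monom y)"
  shows "f u v = g u v"
proof -
  have "f (monom x) v = g (monom x) v" for x
    by (rule lin_eq_on_monom) (use assms in auto)
  then show ?thesis
    by (rule lin_eq_on_monom[where f = "\<lambda>u. f u v" and g = "\<lambda>u. g u v", OF assms(1,3)])
qed

lemma dia_one_left [simp]: "dia 1 v = v"
  by (rule lin_eq_on_monom[where f = "dia 1" and g = "\<lambda>v. v"])
    (use dia_monom[of "[]"] in \<open>auto intro!: lin_rules\<close>)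

lemma dia_word_Nil_right: "dia_word x [] = monom x"
proof (induction x)
  case (Cons l x)
  then show ?case by (cases l) (simp_all add: monom_Cons algebra_simps)
qed simp

lemma dia_one_right [simp]: "dia u 1 = u"
  by (rule lin_eq_on_monom[where f = "\<lambda>u. dia u 1" and g = "\<lambda>v. v"])
    (use dia_monom[of _ "[]"] in \<open>auto simp: dia_word_Nil_right intro!: lin_rules\<close>)

lemma e_times_monom: "e_poly * monom w = monom (LA # w) - monom (LB # w)"
  by (simp add: monom_Cons algebra_simps)

lemma dia_e_left: "dia (e_poly * u) v = e_poly * dia u v"
  by (rule bilinear_eq_on_monom[of "\<lambda>u v. dia (e_poly * u) v" "\<lambda>u v. e_poly * dia u v"])
    (intro lin_rules | simp add: e_times_monom dia_diff)+

text \<open>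
  On the left this is immediate from the recursion, which inspects the first argument first. On the
  right an induction on the first word is needed.
\<close>

lemma dia_e_right: "dia u (e_poly * v) = e_poly * dia u v"
proof (rule bilinear_eq_on_monom[of "\<lambda>u v. dia u (e_poly * v)" "\<lambda>u v. e_poly * dia u v"])
  fix x y
  have "dia_word x (LA # y) - dia_word x (LB # y) = (e_poly * dia_word x y :: 'a ab_poly)"
  proof (induction x)
    case Nil
    show ?case by (simp add: e_times_monom)
  next
    case (Cons l x)
    show ?case
    proof (cases l)
      case LA
      have "(dia_word (LA # x) (LA # y) - dia_word (LA # x) (LB # y) :: 'a ab_poly)
          = e_poly * (dia_word x (LA # y) - dia_word x (LB # y)) + e_poly * dia_word (LB # x) y"
        by (simp add: algebra_simps)
      also have "\<dots> = e_poly * dia_word (LA # x) y"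
        unfolding Cons by (simp add: distrib_left)
      finally show ?thesis
        unfolding LA .
    qed simp
  qed
  then show "dia (monom x) (e_poly * monom y) = (e_poly * dia (monom x) (monom y) :: 'a ab_poly)"
    by (simp add: e_times_monom dia_diff)
qed (intro lin_rules)+

lemma dia_bb: "dia (var_b * u) (var_b * v) = var_b * mix u v"
  by (rule bilinear_eq_on_monom[of "\<lambda>u v. dia (var_b * u) (var_b * v)" "\<lambda>u v. var_b * mix u v"])
    (intro lin_rules lin_mix | simp add: mix_def flip: monom_Cons)+


section \<open>The deconcatenation coaction\<close>

text \<open>
  The coaction \<open>u \<mapsto> u \<otimes> 1 + \<Sum> u1 \<otimes> b u2\<close> is represented without tensors: \<open>coact B u\<close> is the image
  of the resulting tensor under the linear map that a bilinear \<open>B\<close> induces. The recursion moves letters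
  from the front of the word into the first argument of \<open>B\<close>; the split at a letter \<open>l\<close>
  replaces \<open>l\<close> by the letter \<open>b\<close> in front of the second part.
\<close>

primrec coact_word :: "('k::field ab_poly \<Rightarrow> 'k ab_poly \<Rightarrow> 'k ab_poly) \<Rightarrow> ab_letter list \<Rightarrow> 'k ab_poly" where
  "coact_word B [] = B 1 1"
| "coact_word B (l # w) = B 1 (var_b * monom w) + coact_word (\<lambda>x. B (monom [l] * x)) w"

definition coact :: "('k::field ab_poly \<Rightarrow> 'k ab_poly \<Rightarrow> 'k ab_poly) \<Rightarrow> 'k ab_poly \<Rightarrow> 'k ab_poly" where
  "coact B = lin_words (coact_word B)"

lemma lin_coact: "lin (coact B)"
  by (simp add: coact_def lin_lin_words)

lemma lin_coact_family:
  assumes "\<And>x y. lin (\<lambda>t. B t x y)"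
  shows "lin (\<lambda>t. coact (B t) u)"
proof -
  have "lin (\<lambda>t. coact_word (B t) w)" for w
    using assms
  proof (induction w arbitrary: B)
    case (Cons l w)
    then show ?case by (simp add: lin_intros)
  qed simp
  then show ?thesis
    unfolding coact_def by (rule lin_lin_words_family)
qed

lemma lin_of_coact:
  assumes "lin f"
  shows "f (coact B u) = coact (\<lambda>x y. f (B x y)) u"
proof -
  have "f (coact_word B w) = coact_word (\<lambda>x y. f (B x y)) w" for w
    by (induction w arbitrary: B) (simp_all add: lin_add[OF assms])
  then show ?thesis
    by (simp add: coact_def lin_words_def lin_of_lin_ext[OF assms])
qed

lemma coact_add_fun: "coact (\<lambda>x y. B x y + C x y) u = coact B u + coact C u"
proof -
  have "coact_word (\<lambda>x y. B x y + C x y) w = coact_word B w + coact_word C w" for w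
    by (induction w arbitrary: B C) (simp_all add: algebra_simps)
  then show ?thesis
    by (simp add: coact_def lin_words_def lin_ext_add_fun)
qed

lemma coact_monom_Cons:
  "coact B (monom (l # w)) = B 1 (var_b * monom w) + coact (\<lambda>x. B (monom [l] * x)) (monom w)"
  by (simp add: coact_def)

lemma coact_one [simp]: "coact B 1 = B 1 1"
  using lin_words_monom[of "coact_word B" "[]"] by (simp add: coact_def)

lemma coact_b:
  assumes "bilinear_op B"
  shows "coact B (var_b * u) = B 1 (var_b * u) + coact (\<lambda>x. B (var_b * x)) u"
proof (rule lin_eq_on_monom[where f = "\<lambda>u. coact B (var_b * u)"])
  have "lin (B 1)"
    using assms by (simp add: bilinear_op_iff)
  then have "lin (\<lambda>u. B 1 (var_b * u))"
    by (rule lin_compose) (intro lin_rules)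
  then show "lin (\<lambda>u. B 1 (var_b * u) + coact (\<lambda>x. B (var_b * x)) u)"
    by (intro lin_intros(3) lin_coact)
  show "lin (\<lambda>u. coact B (var_b * u))"
    by (rule lin_compose[OF lin_coact]) (intro lin_rules)
  show "coact B (var_b * monom w) = B 1 (var_b * monom w) + coact (\<lambda>x. B (var_b * x)) (monom w)" for w
    using coact_monom_Cons[of B LB w] by (simp add: monom_Cons)
qed

text \<open>The splits at a leading \<open>a\<close> and at a leading \<open>b\<close> agree, so no split occurs at a leading \<open>e\<close>.\<close>

lemma coact_e:
  assumes "bilinear_op B"
  shows "coact B (e_poly * u) = coact (\<lambda>x. B (e_poly * x)) u"
proof (rule lin_eq_on_monom[where f = "\<lambda>u. coact B (e_poly * u)"])
  fix w
  have "B (var_a * x) y = B (e_poly * x) y + B (var_b * x) y" for x y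
    using assms lin_add[of "\<lambda>x. B x y" "e_poly * x" "var_b * x"]
    by (simp add: bilinear_op_iff algebra_simps)
  then have "(\<lambda>x. B (var_a * x)) = (\<lambda>x y. B (e_poly * x) y + B (var_b * x) y)"
    by (intro ext)
  then have "coact (\<lambda>x. B (var_a * x)) (monom w)
      = coact (\<lambda>x. B (e_poly * x)) (monom w) + coact (\<lambda>x. B (var_b * x)) (monom w)"
    by (simp only: coact_add_fun)
  then show "coact B (e_poly * monom w) = coact (\<lambda>x. B (e_poly * x)) (monom w)"
    by (simp add: e_times_monom lin_diff[OF lin_coact] coact_monom_Cons)
       (simp add: monom_Cons)
  show "lin (\<lambda>u. coact B (e_poly * u))"
    by (rule lin_compose[OF lin_coact]) (intro lin_rules)
qed (rule lin_coact)

text \<open>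
  The second parts are \<open>1\<close> or \<open>b\<close> times a word that is shorter than \<open>w\<close>, which is what lets an induction
  hypothesis on length be applied under the coaction.
\<close>

lemma coact_monom_cong:
  assumes "\<And>x. B x 1 = C x 1"
    and "\<And>x w'. length w' < length w \<Longrightarrow> B x (var_b * monom w') = C x (var_b * monom w')"
  shows "coact B (monom w) = coact C (monom w)"
  using assms
proof (induction w arbitrary: B C)
  case Nil
  then show ?case by simp
next
  case (Cons l w)
  show ?case
    unfolding coact_monom_Cons using Cons.prems by (intro arg_cong2[of _ _ _ _ "(+)"] Cons.IH) auto
qed

text \<open>The image under \<open>B\<close> of the product of the coactions of \<open>u\<close> and \<open>v\<close>, formed by \<^const>\<open>dia\<close> in both factors.\<close>

definition coact2 :: "('k::field ab_poly \<Rightarrow> 'k ab_poly \<Rightarrow> 'k ab_poly) \<Rightarrow> 'k ab_poly \<Rightarrow> 'k ab_poly \<Rightarrow> 'k ab_poly" where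
  "coact2 B u v = coact (\<lambda>x x'. coact (\<lambda>y y'. B (dia x y) (dia x' y')) v) u"

lemma bilinear_op_compose:
  assumes "bilinear_op B" "lin f" "lin g"
  shows "bilinear_op (\<lambda>x y. B (f x) (g y))"
proof -
  have "lin (\<lambda>x. B (f x) y)" for y
    using assms by (auto simp: bilinear_op_iff intro: lin_compose[of "\<lambda>x. B x y" f])
  moreover have "lin (\<lambda>y. B x (g y))" for x
    using assms by (auto simp: bilinear_op_iff intro: lin_compose[of "B x" g])
  ultimately show ?thesis by (simp add: bilinear_op_iff)
qed

lemma bilinear_op_coact:
  assumes "\<And>y y'. bilinear_op (\<lambda>x x'. B x x' y y')"
  shows "bilinear_op (\<lambda>x x'. coact (B x x') v)"
  using assms unfolding bilinear_op_iff
  by (intro conjI allI lin_coact_family) (auto simp: bilinear_op_iff)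

lemma bilinear_dia_dia:
  assumes "bilinear_op B"
  shows "bilinear_op (\<lambda>x x'. B (dia x y) (dia x' y'))" "bilinear_op (\<lambda>y y'. B (dia x y) (dia x' y'))"
  by (intro bilinear_op_compose[OF assms] lin_rules)+

lemma coact2_b_left:
  assumes "bilinear_op B"
  shows "coact2 B (var_b * u) v
    = coact (\<lambda>y y'. B y (dia (var_b * u) y')) v
      + coact (\<lambda>x x'. coact (\<lambda>y y'. B (dia (var_b * x) y) (dia x' y')) v) u"
  unfolding coact2_def
  by (subst coact_b) (auto intro!: bilinear_op_coact bilinear_dia_dia assms)

lemma coact_dia_b_right:
  assumes "bilinear_op B"
  shows "coact (\<lambda>y y'. B (dia x y) (dia x' y')) (var_b * v)
    = B x (dia x' (var_b * v)) + coact (\<lambda>y y'. B (dia x (var_b * y)) (dia x' y')) v"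
  by (subst coact_b) (auto intro!: bilinear_dia_dia assms)

text \<open>
  This is multiplicativity of deconcatenation for quasi-shuffles. For \<open>dia (b u) (b v)\<close> the coaction
  contributes \<open>1 \<otimes> b mix u v\<close> plus \<open>b\<close> times the coaction of \<open>mix u v\<close>. On the other side, \<open>b u\<close> has
  the coaction \<open>1 \<otimes> b u\<close> plus \<open>b\<close> times that of \<open>u\<close>, and likewise \<open>b v\<close>; the four products of these
  match the summands of the three induction hypotheses. The form \<open>B\<close> has to vary, because a
  letter that stays in the first factor is absorbed into it.
\<close>

lemma coact_dia:
  assumes "bilinear_op B"
  shows "coact B (dia u v) = coact2 B u v"
  using assms
proof (induction u v arbitrary: B rule: eb_induct2)
  case (add1 u u' v)
  then show ?case
    by (simp add: dia_add lin_add[OF lin_coact] coact2_def)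
next
  case (scale1 c u v)
  then show ?case
    by (simp add: dia_scale lin_scale[OF lin_coact] coact2_def)
next
  case (add2 u v v')
  then show ?case
    by (simp add: dia_add lin_add[OF lin_coact] coact2_def coact_add_fun)
next
  case (scale2 c u v)
  then show ?case
    by (simp add: dia_scale lin_scale[OF lin_coact] coact2_def
        lin_of_coact[where f = "scale c"] lin_intros)
next
  case (one1 v)
  show ?case by (simp add: coact2_def)
next
  case (one2 u)
  show ?case by (simp add: coact2_def)
next
  case (e1 u v)
  have bil: "bilinear_op (\<lambda>x. B (e_poly * x))"
    by (rule bilinear_op_compose[where g = "\<lambda>y. y"]) (intro e1 lin_rules)+
  have "coact B (dia (e_poly * u) v) = coact2 (\<lambda>x. B (e_poly * x)) u v"
    by (simp add: dia_e_left coact_e e1 bil)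
  also have "\<dots> = coact2 B (e_poly * u) v"
    unfolding coact2_def
    by (subst coact_e) (auto intro!: bilinear_op_coact bilinear_dia_dia e1(2) simp: dia_e_left)
  finally show ?case .
next
  case (e2 u v)
  have bil: "bilinear_op (\<lambda>x. B (e_poly * x))"
    by (rule bilinear_op_compose[where g = "\<lambda>y. y"]) (intro e2 lin_rules)+
  have "coact B (dia u (e_poly * v)) = coact2 (\<lambda>x. B (e_poly * x)) u v"
    by (simp add: dia_e_right coact_e e2 bil)
  also have "\<dots> = coact2 B u (e_poly * v)"
    unfolding coact2_def
    by (subst coact_e) (auto intro!: bilinear_dia_dia e2(2) simp: dia_e_right)
  finally show ?case .
next
  case (bb u v)
  let ?Bb = "\<lambda>x. B (var_b * x)"
  let ?Bbe = "\<lambda>x. B (var_b * (e_poly * x))"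
  have bil: "bilinear_op ?Bb" "bilinear_op ?Bbe"
    by (rule bilinear_op_compose[where g = "\<lambda>y. y", OF bb(4)]; intro lin_rules)+
  \<comment> \<open>collects the terms in which both leading letters \<open>b\<close> stay in the first factor\<close>
  have split: "?Bb (dia x (var_b * y)) z + (?Bb (dia (var_b * x) y) z + ?Bbe (dia x y) z)
      = B (dia (var_b * x) (var_b * y)) z" for x y z
    using bb(4) lin_add[of "\<lambda>x. B x z"]
    by (simp add: bilinear_op_iff dia_bb mix_def distrib_left add.assoc)
  have "coact B (dia (var_b * u) (var_b * v))
      = B 1 (var_b * mix u v) + coact ?Bb (mix u v)"
    by (simp add: dia_bb coact_b bb(4))
  also have "coact ?Bb (mix u v) = coact2 ?Bb u (var_b * v) + coact2 ?Bb (var_b * u) v + coact2 ?Bbe u v"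
    using bb(1)[OF bil(1)] bb(2)[OF bil(1)] bb(3)[OF bil(2)]
    by (simp add: mix_def lin_add[OF lin_coact] coact_e[OF bil(1)])
  also have "coact2 ?Bb u (var_b * v) = coact (\<lambda>x x'. ?Bb x (dia x' (var_b * v))) u
      + coact (\<lambda>x x'. coact (\<lambda>y y'. ?Bb (dia x (var_b * y)) (dia x' y')) v) u"
    unfolding coact2_def coact_dia_b_right[OF bil(1)] coact_add_fun ..
  also have "coact2 ?Bb (var_b * u) v = coact (\<lambda>y y'. ?Bb y (dia (var_b * u) y')) v
      + coact (\<lambda>x x'. coact (\<lambda>y y'. ?Bb (dia (var_b * x) y) (dia x' y')) v) u"
    by (rule coact2_b_left[OF bil(1)])
  finally have lhs: "coact B (dia (var_b * u) (var_b * v)) = B 1 (var_b * mix u v)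
      + coact (\<lambda>x x'. ?Bb x (dia x' (var_b * v))) u
      + coact (\<lambda>y y'. ?Bb y (dia (var_b * u) y')) v
      + coact (\<lambda>x x'. coact (\<lambda>y y'. B (dia (var_b * x) (var_b * y)) (dia x' y')) v) u"
    unfolding split[symmetric] coact_add_fun coact2_def by (simp add: algebra_simps)
  have "coact2 B (var_b * u) (var_b * v)
      = coact (\<lambda>y y'. B y (dia (var_b * u) y')) (var_b * v)
      + coact (\<lambda>x x'. coact (\<lambda>y y'. B (dia (var_b * x) y) (dia x' y')) (var_b * v)) u"
    by (rule coact2_b_left[OF bb(4)])
  also have "coact (\<lambda>y y'. B y (dia (var_b * u) y')) (var_b * v)
      = B 1 (var_b * mix u v) + coact (\<lambda>y y'. ?Bb y (dia (var_b * u) y')) v"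
    using coact_dia_b_right[OF bb(4), of 1 "var_b * u" v] by (simp add: dia_bb)
  finally show ?case
    unfolding lhs coact_dia_b_right[OF bb(4)] coact_add_fun by (simp add: algebra_simps)
qed

section \<open>Multiplicativity from the coaction\<close>

text \<open>
  The polynomials in \<open>e\<close> have this property, in particular the values of \<open>hat G\<close>.
\<close>

definition pulls_out :: "'k::field ab_poly \<Rightarrow> bool" where
  "pulls_out p \<longleftrightarrow> (\<forall>u v. dia (p * u) v = p * dia u v \<and> dia u (p * v) = p * dia u v)"

lemma dia_e_power:
  "dia (e_poly ^ n * u) v = e_poly ^ n * dia u v" "dia u (e_poly ^ n * v) = e_poly ^ n * dia u v"
  by (induction n) (simp_all add: dia_e_left dia_e_right mult.assoc)

lemma pulls_out_scale_e_power: "pulls_out (scale c (e_poly ^ n))"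
  by (simp add: pulls_out_def dia_scale dia_e_power)

text \<open>
  Removes a leading \<open>b\<close> and then applies \<open>f\<close>. The value on words with leading \<open>a\<close> is arbitrary; the value
  \<open>0\<close> at the empty word matters, since it discards the trivial split \<open>1 \<otimes> u\<close>.
\<close>

definition strip_b :: "('k::field ab_poly \<Rightarrow> 'k ab_poly) \<Rightarrow> 'k ab_poly \<Rightarrow> 'k ab_poly" where
  "strip_b f = lin_words (\<lambda>w. case w of LB # w' \<Rightarrow> f (monom w') | _ \<Rightarrow> 0)"

lemma lin_strip_b: "lin (strip_b f)"
  by (simp add: strip_b_def lin_lin_words)

lemma strip_b_one: "strip_b f 1 = 0"
  by (simp add: strip_b_def flip: monom_Nil)

lemma strip_b_b:
  assumes "lin f"
  shows "strip_b f (var_b * u) = f u"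
proof (rule lin_eq_on_monom[where f = "\<lambda>u. strip_b f (var_b * u)"])
  show "lin (\<lambda>u. strip_b f (var_b * u))"
    by (rule lin_compose[OF lin_strip_b]) (intro lin_rules)
  show "strip_b f (var_b * monom w) = f (monom w)" for w
    by (simp add: strip_b_def flip: monom_Cons)
qed (rule assms)

lemma coact_mult_left: "coact (\<lambda>x y. p * B x y) u = p * coact B u"
  by (rule lin_of_coact[symmetric]) (intro lin_rules)

text \<open>
  With \<open>h u = \<Sum> \<gamma>(u1) g(u2)\<close> over the coaction, the assumption on \<open>g\<close> reads \<open>g (b u) = b h u\<close>, and
  multiplicativity on a pair \<open>b u\<close>, \<open>b v\<close> amounts to \<open>h (mix u v) = mix (h u) (h v)\<close>. Let \<open>J (b u) = b \<gamma> u\<close> and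
  \<open>J 1 = 0\<close>. Then \<open>g (dia (b u) (b v))\<close> is the sum of \<open>J(z1) g(z2)\<close> over the coaction of
  \<open>dia (b u) (b v)\<close>, which factorizes. The splits in which \<open>b v\<close>, or \<open>b u\<close>, remains whole in the second
  factor give \<open>b dia (h u) (b h v)\<close> and \<open>b dia (b h u) (h v)\<close>; those in which neither does give
  \<open>b e dia (h u) (h v)\<close> by the assumption on \<open>\<gamma>\<close> and \<open>mix\<close>.
\<close>

lemma diamond_hom_from_coaction:
  fixes g \<gamma> :: "'k::field ab_poly \<Rightarrow> 'k ab_poly"
  assumes g: "lin g" and \<gamma>: "lin \<gamma>"
    and g_one: "g 1 = 1" and g_e: "\<And>u. g (e_poly * u) = e_poly * g u"
    and g_b: "\<And>u. g (var_b * u) = var_b * coact (\<lambda>x y. \<gamma> x * g y) u"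
    and \<gamma>_mix: "\<And>u v. \<gamma> (mix u v) = e_poly * (\<gamma> u * \<gamma> v)"
    and \<gamma>_out: "\<And>u. pulls_out (\<gamma> u)"
  shows "g (dia u v) = dia (g u) (g v)"
proof -
  define h where "h = coact (\<lambda>x y. \<gamma> x * g y)"
  define J where "J = (\<lambda>u. var_b * strip_b \<gamma> u)"
  have J: "lin J" "J 1 = 0" "\<And>u. J (var_b * u) = var_b * \<gamma> u"
    by (simp_all add: J_def lin_mult lin_strip_b strip_b_one strip_b_b \<gamma>)
  have gh: "g (var_b * u) = var_b * h u" for u
    by (simp add: g_b h_def)
  have out: "dia (\<gamma> x * u) v = \<gamma> x * dia u v" "dia u (\<gamma> x * v) = \<gamma> x * dia u v" for x u v
    using \<gamma>_out by (auto simp: pulls_out_def)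
  have bilJ: "bilinear_op (\<lambda>x y. J x * g y)"
    by (auto simp: bilinear_op_iff intro!: lin_mult J g)
  note lin_g = lin_compose[OF g]
  note lin_J = lin_compose[OF J(1)]

  \<comment> \<open>words instead of general polynomials, because the induction is on length\<close>
  have bb: "g (dia (var_b * monom x) (var_b * monom y)) = dia (g (var_b * monom x)) (g (var_b * monom y))" for x y
  proof (induction "length x + length y" arbitrary: x y rule: less_induct)
    case less
    let ?u = "monom x :: 'k ab_poly" and ?v = "monom y :: 'k ab_poly"
    let ?T = "\<lambda>z z'. coact (\<lambda>w w'. (var_b * (e_poly * (\<gamma> z * \<gamma> w))) * dia (g z') (g w')) ?v"
    have "g (dia (var_b * ?u) (var_b * ?v)) = var_b * coact (\<lambda>x y. \<gamma> x * g y) (mix ?u ?v)"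
      by (simp add: dia_bb g_b)
    also have "\<dots> = coact (\<lambda>x y. J x * g y) (var_b * mix ?u ?v)"
      unfolding coact_b[OF bilJ] by (simp add: J mult.assoc coact_mult_left)
    also have "\<dots> = coact2 (\<lambda>x y. J x * g y) (var_b * ?u) (var_b * ?v)"
      by (simp add: coact_dia[OF bilJ] flip: dia_bb)
    also have "\<dots> = coact (\<lambda>w w'. J w * g (dia (var_b * ?u) w')) (var_b * ?v)
        + coact (\<lambda>z z'. coact (\<lambda>w w'. J (dia (var_b * z) w) * g (dia z' w')) (var_b * ?v)) ?u"
      by (rule coact2_b_left[OF bilJ])
    also have "coact (\<lambda>w w'. J w * g (dia (var_b * ?u) w')) (var_b * ?v)
        = coact (\<lambda>w w'. (var_b * \<gamma> w) * g (dia (var_b * ?u) w')) ?v"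
      using coact_dia_b_right[OF bilJ, of 1 "var_b * ?u" ?v] by (simp add: J)
    also have "\<dots> = coact (\<lambda>w w'. (var_b * \<gamma> w) * dia (g (var_b * ?u)) (g w')) ?v"
      by (rule coact_monom_cong) (simp_all add: less g_one)
    also have "\<dots> = var_b * dia (g (var_b * ?u)) (h ?v)"
      unfolding h_def
      by (subst lin_of_coact[where f = "dia _"]) (auto simp: lin_dia lin_intros out mult.assoc coact_mult_left)
    also have "coact (\<lambda>z z'. coact (\<lambda>w w'. J (dia (var_b * z) w) * g (dia z' w')) (var_b * ?v)) ?u
        = coact (\<lambda>z z'. var_b * \<gamma> z * g (dia z' (var_b * ?v))
           + coact (\<lambda>w w'. (var_b * (e_poly * (\<gamma> z * \<gamma> w))) * g (dia z' w')) ?v) ?u"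
      unfolding coact_dia_b_right[OF bilJ] dia_bb J(3) \<gamma>_mix ..
    also have "\<dots> = coact (\<lambda>z z'. var_b * \<gamma> z * dia (g z') (g (var_b * ?v)) + ?T z z') ?u"
      by (intro coact_monom_cong arg_cong2[of _ _ _ _ "(+)"]) (simp_all add: less g_one)
    also have "\<dots> = coact (\<lambda>z z'. var_b * \<gamma> z * dia (g z') (g (var_b * ?v))) ?u + coact ?T ?u"
      by (rule coact_add_fun)
    also have "coact (\<lambda>z z'. var_b * \<gamma> z * dia (g z') (g (var_b * ?v))) ?u
        = var_b * dia (h ?u) (g (var_b * ?v))"
      unfolding h_def
      by (subst lin_of_coact[where f = "\<lambda>x. dia x _"])
        (auto simp: lin_dia lin_intros out mult.assoc coact_mult_left)
    also have "coact ?T ?u = var_b * (e_poly * dia (h ?u) (h ?v))"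
    proof -
      have "dia (\<gamma> z * g z') (h ?v) = coact (\<lambda>w w'. (\<gamma> z * \<gamma> w) * dia (g z') (g w')) ?v" for z z'
        unfolding h_def out(1)
        by (subst lin_of_coact[where f = "dia _"])
          (auto simp: lin_dia lin_intros out(2) mult.assoc coact_mult_left)
      then have "dia (h ?u) (h ?v)
          = coact (\<lambda>z z'. coact (\<lambda>w w'. (\<gamma> z * \<gamma> w) * dia (g z') (g w')) ?v) ?u"
        unfolding h_def
        by (subst lin_of_coact[where f = "\<lambda>x. dia x _"]) (auto simp: lin_dia lin_intros)
      then show ?thesis
        by (simp add: mult.assoc coact_mult_left)
    qed
    finally show ?case
      by (simp add: gh dia_bb mix_def distrib_left algebra_simps)
  qed
  have "g (dia (var_b * u) (var_b * v)) = dia (g (var_b * u)) (g (var_b * v))" for u v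
    by (rule bilinear_eq_on_monom[of "\<lambda>u v. g (dia (var_b * u) (var_b * v))"
          "\<lambda>u v. dia (g (var_b * u)) (g (var_b * v))"])
      (intro lin_g lin_rules | rule lin_g | simp add: bb)+
  then show ?thesis
  proof (induction u v rule: eb_induct2)
    case (e1 u v)
    then show ?case by (simp add: dia_e_left g_e)
  next
    case (e2 u v)
    then show ?case by (simp add: dia_e_right g_e)
  qed (simp_all add: dia_add dia_scale lin_add[OF g] lin_scale[OF g] g_one)
qed

section \<open>Graded posets\<close>

lemma aboveS_iff [simp]: "y \<in> aboveS P x \<longleftrightarrow> (x, y) \<in> P - Id"
  by (auto simp: aboveS_def)

lemma bottom_of_eq: "antisym P \<Longrightarrow> is_bottom P z \<Longrightarrow> bottom_of P = z"
  unfolding bottom_of_def by (rule the_equality) (auto simp: is_bottom_def dest: antisymD)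

lemma top_of_eq: "antisym P \<Longrightarrow> is_top P z \<Longrightarrow> top_of P = z"
  unfolding top_of_def by (rule the_equality) (auto simp: is_top_def dest: antisymD)

lemma graded_posetI:
  assumes "finite (Field P)" "\<And>x. x \<in> Field P \<Longrightarrow> (x, x) \<in> P" "antisym P" "trans P"
    and "is_bottom P z" "is_top P t"
    and "\<rho> z = 0" "\<And>x y. covered_by P x y \<Longrightarrow> \<rho> y = \<rho> x + 1"
  shows "graded_poset P" "rank_function P \<rho>"
proof -
  show "rank_function P \<rho>"
    using assms by (simp add: rank_function_def bottom_of_eq[of P z])
  then show "graded_poset P"
    using assms unfolding graded_poset_def partial_order_on_def preorder_on_def
    by (auto simp: refl_on_def FieldI1 FieldI2)
qed

context
  fixes P :: "'a rel"
  assumes gr: "graded_poset P"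
begin

lemma graded_finite: "finite (Field P)"
  and graded_refl: "x \<in> Field P \<Longrightarrow> (x, x) \<in> P"
  and graded_antisym: "antisym P"
  and graded_trans: "trans P"
  using gr unfolding graded_poset_def partial_order_on_def preorder_on_def
  by (auto simp: refl_on_def)

lemma is_bottom_bottom_of: "is_bottom P (bottom_of P)"
  and is_top_top_of: "is_top P (top_of P)"
  using gr bottom_of_eq[OF graded_antisym] top_of_eq[OF graded_antisym]
  by (auto simp: graded_poset_def)

lemma bottom_in_Field: "bottom_of P \<in> Field P"
  and bottom_le: "x \<in> Field P \<Longrightarrow> (bottom_of P, x) \<in> P"
  and top_in_Field: "top_of P \<in> Field P"
  and top_ge: "x \<in> Field P \<Longrightarrow> (x, top_of P) \<in> P"
  using is_bottom_bottom_of is_top_top_of by (auto simp: is_bottom_def is_top_def)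

lemma strict_trans: "(x, y) \<in> P \<Longrightarrow> (y, z) \<in> P - Id \<Longrightarrow> (x, z) \<in> P - Id"
  "(x, y) \<in> P - Id \<Longrightarrow> (y, z) \<in> P \<Longrightarrow> (x, z) \<in> P - Id"
  using graded_antisym graded_trans by (auto dest: transD antisymD)

lemma below_psubset:
  assumes "(z, y) \<in> P - Id"
  shows "{w. (w, z) \<in> P - Id} \<subset> {w. (w, y) \<in> P - Id}"
  using assms strict_trans(2) by blast

lemma finite_aboveS: "finite (aboveS P x)"
  by (rule finite_subset[OF _ graded_finite]) (auto intro: FieldI2)

lemma aboveS_top: "aboveS P (top_of P) = {}"
  using top_ge graded_antisym by (auto simp: aboveS_def dest: antisymD FieldI2)

lemma aboveS_bottom: "aboveS P (bottom_of P) = Field P - {bottom_of P}"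
  using bottom_le by (auto intro: FieldI2)

lemma rank_function_rank: "rank_function P (rank P)"
  using gr unfolding rank_def graded_poset_def by (metis someI_ex)

lemma rank_bottom: "rank P (bottom_of P) = 0"
  and rank_covered: "covered_by P x y \<Longrightarrow> rank P y = rank P x + 1"
  using rank_function_rank by (auto simp: rank_function_def)

lemma covered_below:
  assumes "(x, y) \<in> P - Id"
  shows "\<exists>z. (x, z) \<in> P \<and> covered_by P z y"
  using assms
proof (induction "card {z. (x, z) \<in> P \<and> (z, y) \<in> P - Id}" arbitrary: x rule: less_induct)
  case less
  show ?case
  proof (cases "covered_by P x y")
    case True
    then show ?thesis using less.prems by (auto intro: graded_refl FieldI1)
  next
    case False
    then obtain w where w: "(x, w) \<in> P - Id" "(w, y) \<in> P - Id"
      using less.prems by (auto simp: covered_by_def)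
    have "{z. (w, z) \<in> P \<and> (z, y) \<in> P - Id} \<subset> {z. (x, z) \<in> P \<and> (z, y) \<in> P - Id}"
      using w less.prems graded_refl[of x] graded_antisym graded_trans
      by (auto dest: transD antisymD FieldI1)
    moreover have "finite {z. (x, z) \<in> P \<and> (z, y) \<in> P - Id}"
      by (rule finite_subset[OF _ graded_finite]) (auto intro: FieldI1)
    ultimately obtain z where "(w, z) \<in> P" "covered_by P z y"
      using less.hyps[of w] w by (meson psubset_card_mono)
    then show ?thesis
      using w graded_trans by (blast dest: transD)
  qed
qed

text \<open>
  Every element other than the bottom covers some element, so the cover condition determines
  a rank function on the whole poset.
\<close>

lemma rank_unique:
  assumes "rank_function P \<rho>" "x \<in> Field P"
  shows "rank P x = \<rho> x"
  using assms(2)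
proof (induction "card {z. (z, x) \<in> P - Id}" arbitrary: x rule: less_induct)
  case less
  show ?case
  proof (cases "x = bottom_of P")
    case True
    then show ?thesis using assms(1) rank_bottom by (simp add: rank_function_def)
  next
    case False
    then obtain z where z: "covered_by P z x"
      using covered_below[of "bottom_of P" x] bottom_le less.prems by auto
    have "{w. (w, z) \<in> P - Id} \<subset> {w. (w, x) \<in> P - Id}"
      using z by (intro below_psubset) (simp add: covered_by_def)
    moreover have "finite {w. (w, x) \<in> P - Id}"
      by (rule finite_subset[OF _ graded_finite]) (auto intro: FieldI1)
    ultimately have "rank P z = \<rho> z"
      using z by (intro less.hyps psubset_card_mono) (auto simp: covered_by_def intro: FieldI1)
    then show ?thesis
      using z assms(1) rank_covered by (simp add: rank_function_def)
  qed
qed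

lemma rank_strict_mono:
  assumes "(x, y) \<in> P - Id"
  shows "rank P x < rank P y"
  using assms
proof (induction "card {z. (z, y) \<in> P - Id}" arbitrary: y rule: less_induct)
  case less
  obtain z where z: "(x, z) \<in> P" "covered_by P z y"
    using covered_below[OF less.prems] by auto
  have "{w. (w, z) \<in> P - Id} \<subset> {w. (w, y) \<in> P - Id}"
    using z by (intro below_psubset) (simp add: covered_by_def)
  moreover have "finite {w. (w, y) \<in> P - Id}"
    by (rule finite_subset[OF _ graded_finite]) (auto intro: FieldI1)
  ultimately have "x = z \<or> rank P x < rank P z"
    using z less.hyps[of z] by (auto intro: psubset_card_mono)
  then show ?case
    using rank_covered[OF z(2)] by auto
qed

lemma rank_pos: "x \<in> Field P \<Longrightarrow> x \<noteq> bottom_of P \<Longrightarrow> 1 \<le> rank P x"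
  using rank_strict_mono[of "bottom_of P" x] bottom_le by auto

lemma poset_rank_pos_iff: "1 \<le> poset_rank P \<longleftrightarrow> bottom_of P \<noteq> top_of P"
  using rank_pos[OF top_in_Field] rank_bottom by (auto simp: poset_rank_def)

end


section \<open>Flag enumeration by recursion over chains\<close>

definition chains_to_top :: "'a rel \<Rightarrow> 'a \<Rightarrow> 'a list set" where
  "chains_to_top P x =
     {xs. xs \<noteq> [] \<and> set xs \<subseteq> Field P \<and> sorted_wrt (\<lambda>x y. (x, y) \<in> P - Id) xs \<and>
          hd xs = x \<and> last xs = top_of P}"

text \<open>
  Each step of a chain carries its own factor \<open>b\<close> here, also the first one. This makes the empty
  product the correct weight of the chain that consists of the top element only, and turns
  the weight into a product over the steps.
\<close>

fun b_chain_weight :: "('a \<Rightarrow> nat) \<Rightarrow> 'a list \<Rightarrow> 'k::field ab_poly" where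
  "b_chain_weight \<rho> (x # y # zs) = var_b * (e_poly ^ (\<rho> y - \<rho> x - 1) * b_chain_weight \<rho> (y # zs))"
| "b_chain_weight \<rho> _ = 1"

definition up_sum :: "'a rel \<Rightarrow> 'a \<Rightarrow> 'k::field ab_poly" where
  "up_sum P x = (\<Sum>xs\<in>chains_to_top P x. b_chain_weight (rank P) xs)"

text \<open>The ab-index of the interval from \<open>x\<close> to the top element; it is 0 for the top element itself.\<close>

definition interval_index :: "'a rel \<Rightarrow> 'a \<Rightarrow> 'k::field ab_poly" where
  "interval_index P x = (\<Sum>y\<in>aboveS P x. e_poly ^ (rank P y - rank P x - 1) * up_sum P y)"

lemma chain_weight_eq:
  "ys \<noteq> [] \<Longrightarrow> chain_weight \<rho> (x # ys) = e_poly ^ (\<rho> (hd ys) - \<rho> x - 1) * b_chain_weight \<rho> ys"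
proof (induction ys arbitrary: x)
  case (Cons y ys)
  then show ?case by (cases ys) (simp_all add: mult.assoc)
qed simp

context
  fixes P :: "'a rel"
  assumes gr: "graded_poset P"
begin

lemma finite_chains_to_top: "finite (chains_to_top P x)"
proof -
  have "distinct xs" if "sorted_wrt (\<lambda>x y. (x, y) \<in> P - Id) xs" for xs
    using that by (induction xs) auto
  then have "chains_to_top P x \<subseteq> {xs. set xs \<subseteq> Field P \<and> distinct xs}"
    by (auto simp: chains_to_top_def)
  then show ?thesis
    using finite_subset finite_subset_distinct[OF graded_finite[OF gr]] by blast
qed

lemma chains_to_top_top: "chains_to_top P (top_of P) = {[top_of P]}"
proof -
  have "xs = [top_of P]" if "xs \<in> chains_to_top P (top_of P)" for xs
  proof (cases xs rule: remdups_adj.cases)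
    case (3 x y zs)
    then have "y \<in> aboveS P (top_of P)"
      using that by (auto simp: chains_to_top_def)
    then show ?thesis using aboveS_top[OF gr] by blast
  qed (use that in \<open>auto simp: chains_to_top_def\<close>)
  then show ?thesis
    using top_in_Field[OF gr] by (auto simp: chains_to_top_def)
qed

lemma chains_to_top_step:
  assumes "x \<in> Field P" "x \<noteq> top_of P"
  shows "chains_to_top P x = (\<Union>y\<in>aboveS P x. (#) x ` chains_to_top P y)"
proof (intro equalityI subsetI)
  fix xs
  assume xs: "xs \<in> chains_to_top P x"
  then obtain ys where ys: "xs = x # ys" "ys \<noteq> []"
    using assms(2) by (cases xs) (auto simp: chains_to_top_def split: if_splits)
  then have "hd ys \<in> aboveS P x" "ys \<in> chains_to_top P (hd ys)"
    using xs by (auto simp: chains_to_top_def)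
  then show "xs \<in> (\<Union>y\<in>aboveS P x. (#) x ` chains_to_top P y)"
    using ys by blast
next
  fix xs
  assume "xs \<in> (\<Union>y\<in>aboveS P x. (#) x ` chains_to_top P y)"
  then obtain y ys where y: "y \<in> aboveS P x" "ys \<in> chains_to_top P y" "xs = x # ys"
    by auto
  then obtain zs where zs: "ys = y # zs"
    by (cases ys) (auto simp: chains_to_top_def)
  have "(x, z) \<in> P - Id" if "z \<in> set ys" for z
    using that y strict_trans(2)[OF gr, of x y z] by (auto simp: zs chains_to_top_def)
  then show "xs \<in> chains_to_top P x"
    using y assms by (auto simp: chains_to_top_def)
qed

lemma sum_chains_to_top:
  assumes "x \<in> Field P" "x \<noteq> top_of P"
  shows "(\<Sum>xs\<in>chains_to_top P x. f xs) = (\<Sum>y\<in>aboveS P x. \<Sum>ys\<in>chains_to_top P y. f (x # ys))"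
proof -
  have "(\<Sum>xs\<in>chains_to_top P x. f xs) = (\<Sum>y\<in>aboveS P x. \<Sum>xs\<in>(#) x ` chains_to_top P y. f xs)"
    unfolding chains_to_top_step[OF assms]
    by (rule sum.UNION_disjoint)
      (use finite_aboveS[OF gr] finite_chains_to_top in \<open>auto simp: chains_to_top_def\<close>)
  then show ?thesis
    by (simp add: sum.reindex)
qed

lemma up_sum_top: "up_sum P (top_of P) = 1"
  by (simp add: up_sum_def chains_to_top_top)

lemma interval_index_top: "interval_index P (top_of P) = 0"
  unfolding interval_index_def aboveS_top[OF gr] by simp

lemma up_sum_step:
  assumes "x \<in> Field P" "x \<noteq> top_of P"
  shows "up_sum P x = var_b * interval_index P x"
proof -
  have "b_chain_weight (rank P) (x # ys)
      = var_b * (e_poly ^ (rank P y - rank P x - 1) * b_chain_weight (rank P) ys)"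
    if "ys \<in> chains_to_top P y" for y ys
    using that by (cases ys) (auto simp: chains_to_top_def)
  then show ?thesis
    unfolding up_sum_def interval_index_def sum_chains_to_top[OF assms] sum_distrib_left
    by (intro sum.cong refl)
qed

lemma ab_index_eq:
  assumes "1 \<le> poset_rank P"
  shows "ab_index P = interval_index P (bottom_of P)"
proof -
  have "chain_weight (rank P) (x # ys)
      = e_poly ^ (rank P y - rank P x - 1) * b_chain_weight (rank P) ys"
    if "ys \<in> chains_to_top P y" for x y ys
    using that by (subst chain_weight_eq) (auto simp: chains_to_top_def)
  moreover have "chains_bot_top P = chains_to_top P (bottom_of P)"
    by (simp add: chains_bot_top_def chains_to_top_def)
  moreover have ne: "bottom_of P \<noteq> top_of P"
    using assms poset_rank_pos_iff[OF gr] by simp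
  ultimately show ?thesis
    unfolding ab_index_def interval_index_def up_sum_def sum_distrib_left
    by (simp only: sum_chains_to_top[OF bottom_in_Field[OF gr] ne]) (intro sum.cong refl, simp)
qed

text \<open>
  Chain sums are identified below by checking the recursion over the first step. An up-closed set \<open>U\<close> is
  enough for this, which is needed for the diamond product, where the new bottom element
  does not fit the pattern of the others.
\<close>

lemma up_sum_unique:
  assumes U: "U \<subseteq> Field P" "\<And>x y. x \<in> U \<Longrightarrow> (x, y) \<in> P \<Longrightarrow> y \<in> U"
    and top: "c (top_of P) = 1"
    and step: "\<And>x. x \<in> U \<Longrightarrow> x \<noteq> top_of P \<Longrightarrow>
       c x = var_b * (\<Sum>y\<in>aboveS P x. e_poly ^ (rank P y - rank P x - 1) * c y)"
    and "x \<in> U"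
  shows "up_sum P x = c x"
  using \<open>x \<in> U\<close>
proof (induction "card (aboveS P x)" arbitrary: x rule: less_induct)
  case less
  show ?case
  proof (cases "x = top_of P")
    case True
    then show ?thesis by (simp add: top up_sum_top)
  next
    case False
    have "up_sum P y = c y" if "y \<in> aboveS P x" for y
    proof (rule less.hyps)
      have "aboveS P y \<subset> aboveS P x"
        using that strict_trans[OF gr] unfolding aboveS_def by blast
      then show "card (aboveS P y) < card (aboveS P x)"
        by (rule psubset_card_mono[OF finite_aboveS[OF gr]])
      show "y \<in> U" using that U(2) less.prems by auto
    qed
    then show ?thesis
      using less.prems U(1) False step[of x]
      by (simp add: up_sum_step subset_iff interval_index_def)
  qed
qed

end

section \<open>Cartesian products of posets\<close>

lemma sum_cong_pair: "(\<And>x y. (x, y) \<in> A \<Longrightarrow> f (x, y) = g x y) \<Longrightarrow> sum f A = (\<Sum>(x, y)\<in>A. g x y)"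
  by (rule sum.cong) auto

lemma Field_poset_prod:
  assumes "graded_poset P" "graded_poset Q"
  shows "Field (poset_prod P Q) = Field P \<times> Field Q"
proof -
  have "(x, y) \<in> Field (poset_prod P Q)" if "x \<in> Field P" "y \<in> Field Q" for x y
    using that graded_refl[OF assms(1), of x] graded_refl[OF assms(2), of y]
    by (intro FieldI1[of _ "(x, y)"]) (simp add: poset_prod_def)
  moreover have "p \<in> Field P \<times> Field Q" if "p \<in> Field (poset_prod P Q)" for p
    using that by (auto simp: Field_def poset_prod_def Domain_iff Range_iff)
  ultimately show ?thesis by auto
qed

text \<open>
  A cover in a product moves just one coordinate, as otherwise \<open>(x', y)\<close> lies strictly in between.
  The hypothesis speaks of the coordinates only, so that it serves the Cartesian and the diamond product.
\<close>

lemma covered_by_poset_prod: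
  assumes "graded_poset P" "graded_poset Q"
    and "(x, x') \<in> P" "(y, y') \<in> Q" "(x, y) \<noteq> (x', y')"
    and no_between: "\<And>z w. (x, z) \<in> P \<Longrightarrow> (z, x') \<in> P \<Longrightarrow> (y, w) \<in> Q \<Longrightarrow> (w, y') \<in> Q \<Longrightarrow>
      (z, w) = (x, y) \<or> (z, w) = (x', y')"
  shows "rank P x' + rank Q y' = rank P x + rank Q y + 1"
proof -
  have refl: "(x, x) \<in> P" "(x', x') \<in> P" "(y, y) \<in> Q" "(y', y') \<in> Q"
    using assms(3,4) by (auto intro: graded_refl[OF assms(1)] graded_refl[OF assms(2)] FieldI1 FieldI2)
  consider "x = x'" "y \<noteq> y'" | "x \<noteq> x'" "y = y'"
    using no_between[of x' y] refl assms(3-5) by auto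
  then show ?thesis
  proof cases
    case 1
    then have "covered_by Q y y'"
      using no_between[of x] refl assms(4) by (auto simp: covered_by_def)
    then show ?thesis using 1 rank_covered[OF assms(2)] by simp
  next
    case 2
    then have "covered_by P x x'"
      using no_between[of _ y] refl assms(3) by (auto simp: covered_by_def)
    then show ?thesis using 2 rank_covered[OF assms(1)] by simp
  qed
qed

lemma graded_poset_prod:
  assumes P: "graded_poset P" and Q: "graded_poset Q"
  shows "graded_poset (poset_prod P Q)"
    and "x \<in> Field P \<Longrightarrow> y \<in> Field Q \<Longrightarrow> rank (poset_prod P Q) (x, y) = rank P x + rank Q y"
    and "bottom_of (poset_prod P Q) = (bottom_of P, bottom_of Q)"
    and "top_of (poset_prod P Q) = (top_of P, top_of Q)"
proof -
  let ?R = "poset_prod P Q"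
  have anti: "antisym ?R"
    using graded_antisym[OF P] graded_antisym[OF Q]
    by (auto simp: poset_prod_def antisym_def)
  note Field = Field_poset_prod[OF P Q]
  have bot: "is_bottom ?R (bottom_of P, bottom_of Q)"
    unfolding is_bottom_def Field
    using P Q by (auto simp: bottom_in_Field poset_prod_def bottom_le)
  have top: "is_top ?R (top_of P, top_of Q)"
    unfolding is_top_def Field
    using P Q by (auto simp: top_in_Field poset_prod_def top_ge)
  have fin: "finite (Field ?R)"
    using P Q by (simp add: Field graded_finite)
  have refl: "(p, p) \<in> ?R" if "p \<in> Field ?R" for p
    using that P Q unfolding Field by (auto simp: poset_prod_def graded_refl)
  have tr: "trans ?R"
  proof (rule transI)
    show "(p, r) \<in> ?R" if "(p, q) \<in> ?R" "(q, r) \<in> ?R" for p q r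
      using that graded_trans[OF P] graded_trans[OF Q]
      by (auto simp: poset_prod_def dest: transD)
  qed
  let ?\<rho> = "\<lambda>(x, y). rank P x + rank Q y"
  have cov: "?\<rho> q = ?\<rho> p + 1" if "covered_by ?R p q" for p q
  proof -
    obtain x y x' y' where pq: "p = (x, y)" "q = (x', y')" by (cases p; cases q)
    have "rank P x' + rank Q y' = rank P x + rank Q y + 1"
      by (rule covered_by_poset_prod[OF P Q])
        (use that in \<open>auto simp: pq covered_by_def poset_prod_def\<close>)
    then show ?thesis by (simp add: pq)
  qed
  have R: "graded_poset ?R" "rank_function ?R ?\<rho>"
    using graded_posetI[OF fin refl anti tr bot top, of ?\<rho>] cov rank_bottom[OF P] rank_bottom[OF Q]
    by auto
  show "graded_poset ?R" by (rule R)
  show "rank ?R (x, y) = rank P x + rank Q y" if "x \<in> Field P" "y \<in> Field Q"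
    using rank_unique[OF R, of "(x, y)"] that by (simp add: Field)
  show "bottom_of ?R = (bottom_of P, bottom_of Q)" "top_of ?R = (top_of P, top_of Q)"
    by (rule bottom_of_eq[OF anti bot] top_of_eq[OF anti top])+
qed

lemma aboveS_poset_prod:
  assumes "graded_poset P" "graded_poset Q" "x \<in> Field P" "y \<in> Field Q"
  shows "aboveS (poset_prod P Q) (x, y)
    = (\<lambda>x'. (x', y)) ` aboveS P x \<union> Pair x ` aboveS Q y \<union> aboveS P x \<times> aboveS Q y"
  using graded_refl[OF assms(1,3)] graded_refl[OF assms(2,4)]
  by (auto simp: poset_prod_def)

text \<open>
  A first step up from \<open>(x, y)\<close> changes the first coordinate, the second, or both. In the last case
  the exponents of \<open>e\<close> of the two steps add up with one extra factor \<open>e\<close>, as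
  \<open>(i + 1) + (j + 1) - 1 = i + j + 1\<close>.
\<close>

lemma sum_aboveS_poset_prod:
  fixes P :: "'a rel" and Q :: "'b rel" and x y
  assumes P: "graded_poset P" and Q: "graded_poset Q" and x: "x \<in> Field P" and y: "y \<in> Field Q"
  shows "(\<Sum>(x', y')\<in>aboveS (poset_prod P Q) (x, y).
        e_poly ^ (rank P x' + rank Q y' - (rank P x + rank Q y) - 1) * dia (up_sum P x') (up_sum Q y'))
    = dia (interval_index P x) (up_sum Q y) + dia (up_sum P x) (interval_index Q y)
      + e_poly * dia (interval_index P x) (interval_index Q y :: 'k::field ab_poly)"
    (is "sum ?f _ = ?A + ?B + ?C")
proof -
  note fin = finite_aboveS[OF P, of x] finite_aboveS[OF Q, of y]
  have "sum ?f (aboveS (poset_prod P Q) (x, y))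
      = sum ?f ((\<lambda>x'. (x', y)) ` aboveS P x) + sum ?f (Pair x ` aboveS Q y)
        + sum ?f (aboveS P x \<times> aboveS Q y)"
    unfolding aboveS_poset_prod[OF assms] using fin
    by (subst sum.union_disjoint; (subst sum.union_disjoint)?) auto
  also have "sum ?f ((\<lambda>x'. (x', y)) ` aboveS P x) = ?A"
    by (subst sum.reindex) (auto simp: inj_on_def interval_index_def dia_sum dia_e_power)
  also have "sum ?f (Pair x ` aboveS Q y) = ?B"
    by (subst sum.reindex) (auto simp: inj_on_def interval_index_def dia_sum dia_e_power)
  also have "sum ?f (aboveS P x \<times> aboveS Q y)
      = (\<Sum>x'\<in>aboveS P x. \<Sum>y'\<in>aboveS Q y. e_poly * (e_poly ^ (rank P x' - rank P x - 1) *
          (e_poly ^ (rank Q y' - rank Q y - 1) * dia (up_sum P x') (up_sum Q y'))))"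
    unfolding sum.cartesian_product
  proof (rule sum_cong_pair)
    fix x' y'
    assume "(x', y') \<in> aboveS P x \<times> aboveS Q y"
    then have "rank P x < rank P x'" "rank Q y < rank Q y'"
      using rank_strict_mono[OF P] rank_strict_mono[OF Q] by auto
    then have "rank P x' + rank Q y' - (rank P x + rank Q y) - 1
        = Suc ((rank P x' - rank P x - 1) + (rank Q y' - rank Q y - 1))"
      by simp
    then show "?f (x', y')
        = e_poly * (e_poly ^ (rank P x' - rank P x - 1) * (e_poly ^ (rank Q y' - rank Q y - 1) *
          dia (up_sum P x') (up_sum Q y' :: 'k ab_poly)))"
      by (simp only: prod.case power_Suc power_add mult.assoc)
  qed
  also have "\<dots> = ?C"
    unfolding interval_index_def dia_sum(1) dia_e_power(1) unfolding dia_sum(2) dia_e_power(2) sum_distrib_left ..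
  finally show ?thesis .
qed

text \<open>
  If both coordinates are below the top this is the rule for \<open>dia (b u) (b v)\<close>. It persists if one of
  them is at the top, where the chain sum is 1 and the interval contributes 0.
\<close>

lemma dia_up_sum_step:
  assumes "graded_poset P" "graded_poset Q" "x \<in> Field P" "y \<in> Field Q" "(x, y) \<noteq> (top_of P, top_of Q)"
  shows "dia (up_sum P x) (up_sum Q y)
    = var_b * (dia (interval_index P x) (up_sum Q y) + dia (up_sum P x) (interval_index Q y)
      + e_poly * dia (interval_index P x) (interval_index Q y))"
proof (cases "x = top_of P \<or> y = top_of Q")
  case True
  then show ?thesis
    using assms by (auto simp: up_sum_top interval_index_top dia_zero up_sum_step)
next
  case False
  then show ?thesis
    using assms by (simp add: up_sum_step dia_bb mix_def)
qed

lemma up_sum_poset_prod: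
  assumes P: "graded_poset P" and Q: "graded_poset Q" and "x \<in> Field P" "y \<in> Field Q"
  shows "up_sum (poset_prod P Q) (x, y) = dia (up_sum P x) (up_sum Q y :: 'k::field ab_poly)"
proof -
  let ?R = "poset_prod P Q" and ?c = "\<lambda>(x, y). dia (up_sum P x) (up_sum Q y) :: 'k ab_poly"
  note R = graded_poset_prod[OF P Q]
  have "up_sum ?R (x, y) = ?c (x, y)"
  proof (rule up_sum_unique[OF R(1), where U = "Field P \<times> Field Q"])
    show "?c (top_of ?R) = 1"
      by (simp add: R up_sum_top P Q)
    show "?c p = var_b * (\<Sum>q\<in>aboveS ?R p. e_poly ^ (rank ?R q - rank ?R p - 1) * ?c q)"
      if "p \<in> Field P \<times> Field Q" "p \<noteq> top_of ?R" for p
    proof -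
      obtain x y where p: "p = (x, y)" "x \<in> Field P" "y \<in> Field Q"
        using \<open>p \<in> _\<close> by auto
      have "(\<Sum>q\<in>aboveS ?R p. e_poly ^ (rank ?R q - rank ?R p - 1) * ?c q)
        = (\<Sum>(x', y')\<in>aboveS ?R (x, y).
            e_poly ^ (rank P x' + rank Q y' - (rank P x + rank Q y) - 1) * dia (up_sum P x') (up_sum Q y'))"
        unfolding p(1)
      proof (rule sum_cong_pair)
        fix x' y'
        assume "(x', y') \<in> aboveS ?R (x, y)"
        then have "x' \<in> Field P" "y' \<in> Field Q"
          by (auto simp: poset_prod_def intro: FieldI2)
        then show "e_poly ^ (rank ?R (x', y') - rank ?R (x, y) - 1) * ?c (x', y')
          = e_poly ^ (rank P x' + rank Q y' - (rank P x + rank Q y) - 1) * dia (up_sum P x') (up_sum Q y' :: 'k ab_poly)"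
          using p by (simp add: R)
      qed
      also note sum_aboveS_poset_prod[OF P Q p(2,3)]
      finally have "(\<Sum>q\<in>aboveS ?R p. e_poly ^ (rank ?R q - rank ?R p - 1) * ?c q)
        = dia (interval_index P x) (up_sum Q y) + dia (up_sum P x) (interval_index Q y)
          + e_poly * dia (interval_index P x) (interval_index Q y)" .
      then show ?thesis
        using that dia_up_sum_step[OF P Q p(2,3)] by (simp only: p(1) R prod.case) simp
    qed
    show "Field P \<times> Field Q \<subseteq> Field ?R"
      by (simp add: Field_poset_prod P Q)
    show "q \<in> Field P \<times> Field Q" if "(p, q) \<in> ?R" for p q
      using that by (auto simp: poset_prod_def intro: FieldI2)
  qed (use assms in simp)
  then show ?thesis by simp
qed

lemma ab_index_poset_prod:
  assumes P: "graded_poset P" "1 \<le> poset_rank P" and Q: "graded_poset Q" "1 \<le> poset_rank Q"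
  shows "ab_index (poset_prod P Q) = mix (ab_index P) (ab_index Q :: 'k::field ab_poly)"
proof -
  let ?R = "poset_prod P Q" and ?z = "(bottom_of P, bottom_of Q)"
  note R = graded_poset_prod[OF P(1) Q(1)]
  note bot = bottom_in_Field[OF P(1)] bottom_in_Field[OF Q(1)]
  have ne: "bottom_of P \<noteq> top_of P" "bottom_of Q \<noteq> top_of Q"
    using assms poset_rank_pos_iff by blast+
  have "1 \<le> poset_rank ?R"
    unfolding poset_rank_pos_iff[OF R(1)] using ne by (simp add: R)
  then have "ab_index ?R = (interval_index ?R ?z :: 'k ab_poly)"
    by (simp add: ab_index_eq[OF R(1)] R)
  also have "\<dots> = (\<Sum>(x', y')\<in>aboveS ?R ?z. e_poly ^ (rank P x' + rank Q y'
        - (rank P (bottom_of P) + rank Q (bottom_of Q)) - 1) * dia (up_sum P x') (up_sum Q y'))"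
    unfolding interval_index_def
  proof (rule sum_cong_pair)
    fix x' y'
    assume "(x', y') \<in> aboveS ?R ?z"
    then have "x' \<in> Field P" "y' \<in> Field Q"
      by (auto simp: poset_prod_def intro: FieldI2)
    then show "e_poly ^ (rank ?R (x', y') - rank ?R ?z - 1) * up_sum ?R (x', y')
        = e_poly ^ (rank P x' + rank Q y' - (rank P (bottom_of P) + rank Q (bottom_of Q)) - 1)
          * dia (up_sum P x') (up_sum Q y' :: 'k ab_poly)"
      using bot by (simp add: R up_sum_poset_prod P Q)
  qed
  also have "\<dots> = mix (ab_index P) (ab_index Q)"
    unfolding sum_aboveS_poset_prod[OF P(1) Q(1) bot] ab_index_eq[OF P] ab_index_eq[OF Q]
    by (simp add: P Q mix_def up_sum_step bot ne)
  finally show ?thesis .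
qed


section \<open>Diamond products of posets\<close>

context
  fixes P :: "'a rel" and Q :: "'b rel"
  assumes P: "graded_poset P" "1 \<le> poset_rank P" and Q: "graded_poset Q" "1 \<le> poset_rank Q"
begin

abbreviation (input) Pp where "Pp \<equiv> Field P - {bottom_of P}"
abbreviation (input) Qp where "Qp \<equiv> Field Q - {bottom_of Q}"

lemma diamond_prod_iff:
  "(None, r) \<in> diamond_prod P Q \<longleftrightarrow> r \<in> insert None (Some ` (Pp \<times> Qp))"
  "(Some p, None) \<notin> diamond_prod P Q"
  "(Some p, Some q) \<in> diamond_prod P Q \<longleftrightarrow> p \<in> Pp \<times> Qp \<and> q \<in> Pp \<times> Qp \<and> (p, q) \<in> poset_prod P Q"
  by (auto simp: diamond_prod_def Let_def)

lemma above_not_bottom: "x \<in> Pp \<Longrightarrow> (x, x') \<in> P \<Longrightarrow> x' \<in> Pp"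
  "y \<in> Qp \<Longrightarrow> (y, y') \<in> Q \<Longrightarrow> y' \<in> Qp"
  using bottom_le[OF P(1)] graded_antisym[OF P(1)] bottom_le[OF Q(1)] graded_antisym[OF Q(1)]
  by (auto dest: antisymD FieldI2)

lemma Field_diamond_prod: "Field (diamond_prod P Q) = insert None (Some ` (Pp \<times> Qp))"
proof (intro equalityI subsetI)
  fix r
  assume "r \<in> Field (diamond_prod P Q)"
  then obtain s where "(r, s) \<in> diamond_prod P Q \<or> (s, r) \<in> diamond_prod P Q"
    by (auto simp: Field_def)
  then show "r \<in> insert None (Some ` (Pp \<times> Qp))"
    by (cases r; cases s) (auto simp: diamond_prod_iff)
next
  fix r
  assume "r \<in> insert None (Some ` (Pp \<times> Qp))"
  then have "(None, r) \<in> diamond_prod P Q"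
    by (simp add: diamond_prod_iff)
  then show "r \<in> Field (diamond_prod P Q)"
    by (rule FieldI2)
qed

lemma ne_top: "top_of P \<in> Pp" "top_of Q \<in> Qp"
  using P Q poset_rank_pos_iff top_in_Field by (metis Diff_iff singletonD)+

lemma graded_diamond_prod:
  shows "graded_poset (diamond_prod P Q)"
    and "rank (diamond_prod P Q) None = 0"
    and "x \<in> Pp \<Longrightarrow> y \<in> Qp \<Longrightarrow> rank (diamond_prod P Q) (Some (x, y)) = rank P x + rank Q y - 1"
    and "bottom_of (diamond_prod P Q) = None"
    and "top_of (diamond_prod P Q) = Some (top_of P, top_of Q)"
proof -
  let ?D = "diamond_prod P Q" and ?\<rho> = "case_option 0 (\<lambda>(x, y). rank P x + rank Q y - 1)"
  note prod = graded_poset_prod[OF P(1) Q(1)]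
  have anti: "antisym ?D"
  proof (rule antisymI)
    show "p = q" if "(p, q) \<in> ?D" "(q, p) \<in> ?D" for p q
      using that graded_antisym[OF prod(1)]
      by (cases p; cases q) (auto simp: diamond_prod_iff dest: antisymD)
  qed
  have bot: "is_bottom ?D None"
    by (auto simp: is_bottom_def Field_diamond_prod diamond_prod_iff)
  have top: "is_top ?D (Some (top_of P, top_of Q))"
    using ne_top P Q by (auto simp: is_top_def Field_diamond_prod diamond_prod_iff poset_prod_def top_ge)
  have fin: "finite (Field ?D)"
    using P Q by (simp add: Field_diamond_prod graded_finite)
  have refl: "(p, p) \<in> ?D" if "p \<in> Field ?D" for p
    using that P Q by (auto simp: Field_diamond_prod diamond_prod_iff poset_prod_def graded_refl)
  have tr: "trans ?D"
  proof (rule transI)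
    show "(p, r) \<in> ?D" if "(p, q) \<in> ?D" "(q, r) \<in> ?D" for p q r
      using that graded_trans[OF prod(1)]
      by (cases p; cases q; cases r) (auto simp: diamond_prod_iff dest: transD)
  qed
  have cov: "?\<rho> q = ?\<rho> p + 1" if cov: "covered_by ?D p q" for p q
  proof -
    have pq: "(p, q) \<in> ?D" "p \<noteq> q"
      and between: "(p, r) \<in> ?D \<Longrightarrow> (r, q) \<in> ?D \<Longrightarrow> r = p \<or> r = q" for r
      using cov by (auto simp: covered_by_def)
    obtain x' y' where q: "q = Some (x', y')" "x' \<in> Pp" "y' \<in> Qp"
      using pq by (cases p; cases q) (auto simp: diamond_prod_iff)
    show ?thesis
    proof (cases p)
      case None
      have "covered_by P (bottom_of P) x'"
        using q bottom_le[OF P(1)] between[of "Some (_, y')"] graded_refl[OF Q(1), of y']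
        by (auto simp: covered_by_def None diamond_prod_iff poset_prod_def intro: FieldI1)
      moreover have "covered_by Q (bottom_of Q) y'"
        using q bottom_le[OF Q(1)] between[of "Some (x', _)"] graded_refl[OF P(1), of x']
        by (auto simp: covered_by_def None diamond_prod_iff poset_prod_def intro: FieldI1)
      ultimately show ?thesis
        using rank_covered[OF P(1)] rank_covered[OF Q(1)] rank_bottom[OF P(1)] rank_bottom[OF Q(1)]
        by (simp add: None q)
    next
      case (Some p')
      then obtain x y where p: "p = Some (x, y)" "x \<in> Pp" "y \<in> Qp" "(x, x') \<in> P" "(y, y') \<in> Q"
        using pq by (cases p') (auto simp: q diamond_prod_iff poset_prod_def)
      have "rank P x' + rank Q y' = rank P x + rank Q y + 1"
      proof (rule covered_by_poset_prod[OF P(1) Q(1) p(4,5)])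
        show "(x, y) \<noteq> (x', y')" using pq by (simp add: p q)
        show "(z, w) = (x, y) \<or> (z, w) = (x', y')"
          if "(x, z) \<in> P" "(z, x') \<in> P" "(y, w) \<in> Q" "(w, y') \<in> Q" for z w
          using between[of "Some (z, w)"] that p q above_not_bottom(1)[of x z] above_not_bottom(2)[of y w]
          by (auto simp: diamond_prod_iff poset_prod_def)
      qed
      moreover have "1 \<le> rank P x"
        using rank_pos[OF P(1), of x] p by simp
      ultimately show ?thesis
        by (simp add: p q)
    qed
  qed
  have D: "graded_poset ?D" "rank_function ?D ?\<rho>"
    using graded_posetI[OF fin refl anti tr bot top, of ?\<rho>] cov by auto
  show "graded_poset ?D" by (rule D)
  show "rank ?D None = 0" "x \<in> Pp \<Longrightarrow> y \<in> Qp \<Longrightarrow> rank ?D (Some (x, y)) = rank P x + rank Q y - 1"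
    using rank_unique[OF D] by (simp_all add: Field_diamond_prod)
  show "bottom_of ?D = None" "top_of ?D = Some (top_of P, top_of Q)"
    by (rule bottom_of_eq[OF anti bot] top_of_eq[OF anti top])+
qed

lemma aboveS_diamond_prod:
  assumes "x \<in> Pp" "y \<in> Qp"
  shows "aboveS (diamond_prod P Q) (Some (x, y)) = Some ` aboveS (poset_prod P Q) (x, y)"
proof -
  have "r \<in> aboveS (diamond_prod P Q) (Some (x, y)) \<longleftrightarrow> r \<in> Some ` aboveS (poset_prod P Q) (x, y)" for r
    using assms above_not_bottom(1)[of x "fst (the r)"] above_not_bottom(2)[of y "snd (the r)"]
    by (cases r) (auto simp: diamond_prod_iff poset_prod_def)
  then show ?thesis by blast
qed

text \<open>The rank of a pair is one less than in the Cartesian product; rank differences, hence weights, are the same.\<close>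

lemma up_sum_diamond_prod:
  assumes "x \<in> Pp" "y \<in> Qp"
  shows "up_sum (diamond_prod P Q) (Some (x, y)) = dia (up_sum P x) (up_sum Q y :: 'k::field ab_poly)"
proof -
  let ?D = "diamond_prod P Q"
  let ?c = "case_option 0 (\<lambda>(x, y). dia (up_sum P x) (up_sum Q y) :: 'k ab_poly)"
  note D = graded_diamond_prod
  have "up_sum ?D (Some (x, y)) = ?c (Some (x, y))"
  proof (rule up_sum_unique[OF D(1), where U = "Some ` (Pp \<times> Qp)"])
    show "?c (top_of ?D) = 1"
      by (simp add: D up_sum_top P Q)
    show "?c p = var_b * (\<Sum>q\<in>aboveS ?D p. e_poly ^ (rank ?D q - rank ?D p - 1) * ?c q)"
      if "p \<in> Some ` (Pp \<times> Qp)" "p \<noteq> top_of ?D" for p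
    proof -
      obtain x y where p: "p = Some (x, y)" "x \<in> Pp" "y \<in> Qp"
        using \<open>p \<in> _\<close> by auto
      have "(\<Sum>q\<in>aboveS ?D p. e_poly ^ (rank ?D q - rank ?D p - 1) * ?c q)
        = (\<Sum>q\<in>aboveS (poset_prod P Q) (x, y). e_poly ^ (rank ?D (Some q) - rank ?D p - 1) * ?c (Some q))"
        unfolding p(1) aboveS_diamond_prod[OF p(2,3)] by (simp add: sum.reindex)
      also have "\<dots> = (\<Sum>(x', y')\<in>aboveS (poset_prod P Q) (x, y).
            e_poly ^ (rank P x' + rank Q y' - (rank P x + rank Q y) - 1) * dia (up_sum P x') (up_sum Q y'))"
        unfolding p(1)
      proof (rule sum_cong_pair)
        fix x' y'
        assume "(x', y') \<in> aboveS (poset_prod P Q) (x, y)"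
        then have *: "x' \<in> Pp" "y' \<in> Qp"
          using p above_not_bottom(1)[of x x'] above_not_bottom(2)[of y y'] by (auto simp: poset_prod_def)
        have "1 \<le> rank P x"
          using rank_pos[OF P(1), of x] p by simp
        then have "rank P x' + rank Q y' - 1 - (rank P x + rank Q y - 1) - 1
            = rank P x' + rank Q y' - (rank P x + rank Q y) - 1"
          by simp
        then show "e_poly ^ (rank ?D (Some (x', y')) - rank ?D (Some (x, y)) - 1) * ?c (Some (x', y'))
          = e_poly ^ (rank P x' + rank Q y' - (rank P x + rank Q y) - 1) * dia (up_sum P x') (up_sum Q y' :: 'k ab_poly)"
          unfolding D(3)[OF *] D(3)[OF p(2,3)] by simp
      qed
      also have "\<dots> = dia (interval_index P x) (up_sum Q y) + dia (up_sum P x) (interval_index Q y)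
          + e_poly * dia (interval_index P x) (interval_index Q y)"
        using p by (intro sum_aboveS_poset_prod P Q) auto
      finally show ?thesis
        using that dia_up_sum_step[OF P(1) Q(1), of x y] p by (simp only: D) simp
    qed
    show "r \<in> Some ` (Pp \<times> Qp)" if "q \<in> Some ` (Pp \<times> Qp)" "(q, r) \<in> ?D" for q r
      using that by (cases r) (auto simp: diamond_prod_iff)
  qed (use assms in \<open>auto simp: Field_diamond_prod\<close>)
  then show ?thesis by simp
qed

text \<open>
  The first step leads from the new bottom to a pair \<open>(x, y)\<close> of rank \<open>rank x + rank y - 1\<close>, so its exponent
  is the sum of those of the first steps to \<open>x\<close> and to \<open>y\<close>, and the sum over all pairs factorizes.
\<close>

lemma ab_index_diamond_prod:
  "ab_index (diamond_prod P Q) = dia (ab_index P) (ab_index Q :: 'k::field ab_poly)"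
proof -
  let ?D = "diamond_prod P Q"
  note D = graded_diamond_prod
  have "1 \<le> poset_rank ?D"
    unfolding poset_rank_pos_iff[OF D(1)] by (simp add: D)
  then have "ab_index ?D = (interval_index ?D None :: 'k ab_poly)"
    by (simp add: ab_index_eq[OF D(1)] D)
  also have "\<dots> = (\<Sum>q\<in>Some ` (Pp \<times> Qp). e_poly ^ (rank ?D q - 1) * up_sum ?D q)"
    using aboveS_bottom[OF D(1)] by (simp add: interval_index_def D Field_diamond_prod)
  also have "\<dots> = (\<Sum>(x, y)\<in>Pp \<times> Qp. e_poly ^ (rank P x - 1) * (e_poly ^ (rank Q y - 1) *
      dia (up_sum P x) (up_sum Q y)))"
    unfolding sum.reindex[OF inj_Some] o_def
  proof (rule sum_cong_pair)
    fix x y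
    assume "(x, y) \<in> Pp \<times> Qp"
    then have xy: "x \<in> Field P" "x \<noteq> bottom_of P" "y \<in> Field Q" "y \<noteq> bottom_of Q"
      by auto
    then have "rank P x + rank Q y - 1 - 1 = (rank P x - 1) + (rank Q y - 1)"
      using rank_pos[OF P(1), of x] rank_pos[OF Q(1), of y] by simp
    then show "e_poly ^ (rank ?D (Some (x, y)) - 1) * up_sum ?D (Some (x, y)) =
        e_poly ^ (rank P x - 1) * (e_poly ^ (rank Q y - 1) * dia (up_sum P x) (up_sum Q y :: 'k ab_poly))"
      using xy by (simp only: D(3) up_sum_diamond_prod Diff_iff singleton_iff simp_thms power_add mult.assoc)
  qed
  also have "\<dots> = dia (ab_index P) (ab_index Q)"
    unfolding ab_index_eq[OF P] ab_index_eq[OF Q] interval_index_def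
      aboveS_bottom[OF P(1)] aboveS_bottom[OF Q(1)] rank_bottom[OF P(1)] rank_bottom[OF Q(1)]
    unfolding dia_sum(1) dia_e_power(1) diff_0_right unfolding dia_sum(2) dia_e_power(2) sum_distrib_left sum.cartesian_product diff_zero ..
  finally show ?thesis .
qed

end

section \<open>The ab-indices span\<close>

text \<open>
  The element \<open>2 i\<close>, and for a letter \<open>b\<close> at position \<open>i - 1\<close> of \<open>w\<close> also \<open>2 i + 1\<close>, form the level \<open>i\<close>; the
  levels \<open>0\<close> and \<open>length w + 1\<close> hold the bottom and the top. Comparability is comparison of levels. A
  level of \<open>m\<close> elements contributes the factor \<open>e + m b\<close> to the ab-index, that is \<open>a\<close> or \<open>a + b\<close>.
\<close>

definition level_elems :: "ab_letter list \<Rightarrow> nat set" where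
  "level_elems w = {x. x div 2 \<le> Suc (length w) \<and>
     (odd x \<longrightarrow> 1 \<le> x div 2 \<and> x div 2 \<le> length w \<and> w ! (x div 2 - 1) = LB)}"

definition level_poset :: "ab_letter list \<Rightarrow> nat rel" where
  "level_poset w = {(x, y). x \<in> level_elems w \<and> y \<in> level_elems w \<and> (x = y \<or> x div 2 < y div 2)}"

lemma finite_level_elems: "finite (level_elems w)"
proof (rule finite_subset)
  show "level_elems w \<subseteq> {..2 * length w + 3}"
    unfolding level_elems_def by auto
qed simp

lemma even_level_elem: "i \<le> Suc (length w) \<Longrightarrow> 2 * i \<in> level_elems w"
  by (simp add: level_elems_def)

lemma level_elems_0: "x \<in> level_elems w \<Longrightarrow> x div 2 = 0 \<Longrightarrow> x = 0"
  by (cases "odd x") (auto simp: level_elems_def)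

lemma level_elems_top: "x \<in> level_elems w \<Longrightarrow> x div 2 = Suc (length w) \<Longrightarrow> x = 2 * Suc (length w)"
  by (cases "odd x") (auto simp: level_elems_def elim: evenE)

lemma Field_level_poset: "Field (level_poset w) = level_elems w"
  by (auto simp: level_poset_def Field_def)

lemma graded_level_poset:
  shows "graded_poset (level_poset w)"
    and "x \<in> level_elems w \<Longrightarrow> rank (level_poset w) x = x div 2"
    and "bottom_of (level_poset w) = 0"
    and "top_of (level_poset w) = 2 * Suc (length w)"
proof -
  let ?P = "level_poset w"
  have anti: "antisym ?P"
    by (auto simp: level_poset_def antisym_def)
  have tr: "trans ?P"
    by (auto simp: level_poset_def trans_def)
  have refl: "(x, x) \<in> ?P" if "x \<in> Field ?P" for x
    using that unfolding Field_level_poset by (simp add: level_poset_def)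
  have fin: "finite (Field ?P)"
    by (simp add: Field_level_poset finite_level_elems)
  have bot: "is_bottom ?P 0"
    using even_level_elem[of 0 w] level_elems_0[of _ w]
    unfolding is_bottom_def Field_level_poset by (auto simp: level_poset_def)
  have top: "is_top ?P (2 * Suc (length w))"
    unfolding is_top_def Field_level_poset
  proof (intro conjI ballI)
    show mem: "2 * Suc (length w) \<in> level_elems w"
      by (rule even_level_elem) simp
    fix x
    assume x: "x \<in> level_elems w"
    then have "x div 2 < Suc (length w) \<or> x div 2 = Suc (length w)"
      by (auto simp: level_elems_def)
    then show "(x, 2 * Suc (length w)) \<in> ?P"
      using level_elems_top[OF x] mem x by (auto simp: level_poset_def)
  qed
  have cov: "y div 2 = x div 2 + 1" if "covered_by ?P x y" for x y
  proof -
    have xy: "x \<in> level_elems w" "y \<in> level_elems w" "x div 2 < y div 2"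
      using that by (auto simp: covered_by_def level_poset_def)
    let ?z = "2 * Suc (x div 2)"
    have "?z \<in> level_elems w"
      using xy by (intro even_level_elem) (auto simp: level_elems_def)
    then have "(x, ?z) \<in> ?P - Id"
      using xy by (auto simp: level_poset_def)
    then have "(?z, y) \<notin> ?P - Id"
      using that by (auto simp: covered_by_def)
    then have "\<not> Suc (x div 2) < y div 2"
      using \<open>?z \<in> _\<close> xy by (auto simp: level_poset_def)
    then show ?thesis using xy by simp
  qed
  have P: "graded_poset ?P" "rank_function ?P (\<lambda>x. x div 2)"
    using graded_posetI[OF fin refl anti tr bot top, of "\<lambda>x. x div 2"] cov by auto
  show "graded_poset ?P" by (rule P)
  show "rank ?P x = x div 2" if "x \<in> level_elems w"
    using rank_unique[OF P] that by (simp add: Field_level_poset)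
  show "bottom_of ?P = 0" "top_of ?P = 2 * Suc (length w)"
    by (rule bottom_of_eq[OF anti bot] top_of_eq[OF anti top])+
qed

abbreviation aab_prod :: "ab_letter list \<Rightarrow> 'k::field ab_poly" where
  "aab_prod w \<equiv> prod_list (map (case_ab_letter var_a (var_a + var_b)) w)"

text \<open>
  Descending induction on the level: the sum over levels above \<open>i\<close> is \<open>e\<close> times the sum over the levels
  above \<open>i + 1\<close>, plus \<open>b\<close> times the same polynomial for each element at level \<open>i + 1\<close>.
\<close>

lemma aab_prod_level_sum:
  fixes w :: "ab_letter list"
  defines "c \<equiv> \<lambda>x. if x = 2 * Suc (length w) then 1 else var_b * aab_prod (drop (x div 2) w) :: 'k::field ab_poly"
  assumes "i \<le> length w"
  shows "(\<Sum>y | y \<in> level_elems w \<and> i < y div 2. e_poly ^ (y div 2 - i - 1) * c y) = aab_prod (drop i w)"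
  using assms(2)
proof (induction rule: inc_induct)
  case base
  have "{y. y \<in> level_elems w \<and> length w < y div 2} = {2 * Suc (length w)}"
  proof (intro equalityI subsetI)
    fix y
    assume y: "y \<in> {y. y \<in> level_elems w \<and> length w < y div 2}"
    then have "y div 2 = Suc (length w)"
      by (simp add: level_elems_def)
    then show "y \<in> {2 * Suc (length w)}"
      using level_elems_top[of y w] y by simp
  qed (use even_level_elem[of "Suc (length w)" w] in simp)
  then show ?case by (simp add: c_def)
next
  case (step i)
  let ?L = "{y. y \<in> level_elems w \<and> y div 2 = Suc i}"
    and ?R = "{y. y \<in> level_elems w \<and> Suc i < y div 2}"
  have "{y. y \<in> level_elems w \<and> i < y div 2} = ?L \<union> ?R"
    by auto
  then have "(\<Sum>y | y \<in> level_elems w \<and> i < y div 2. e_poly ^ (y div 2 - i - 1) * c y)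
      = (\<Sum>y\<in>?L. e_poly ^ (y div 2 - i - 1) * c y) + (\<Sum>y\<in>?R. e_poly ^ (y div 2 - i - 1) * c y)"
    using finite_level_elems[of w] by (simp only:) (rule sum.union_disjoint, auto)
  also have "(\<Sum>y\<in>?R. e_poly ^ (y div 2 - i - 1) * c y)
      = (\<Sum>y\<in>?R. e_poly * (e_poly ^ (y div 2 - Suc i - 1) * c y))"
  proof (intro sum.cong refl)
    fix y
    assume "y \<in> ?R"
    then have "y div 2 - i - 1 = Suc (y div 2 - Suc i - 1)"
      by (simp add: Suc_diff_Suc)
    then show "e_poly ^ (y div 2 - i - 1) * c y = e_poly * (e_poly ^ (y div 2 - Suc i - 1) * c y)"
      by (simp only: power_Suc mult.assoc)
  qed
  also have "\<dots> = e_poly * aab_prod (drop (Suc i) w)"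
    using step.IH by (simp flip: sum_distrib_left)
  also have "(\<Sum>y\<in>?L. e_poly ^ (y div 2 - i - 1) * c y) = (\<Sum>y\<in>?L. var_b * aab_prod (drop (Suc i) w))"
    using step.hyps by (intro sum.cong) (auto simp: c_def)
  also have "\<dots> = (case w ! i of LA \<Rightarrow> var_b | LB \<Rightarrow> var_b + var_b) * aab_prod (drop (Suc i) w)"
  proof -
    have "?L = {2 * Suc i} \<union> (if w ! i = LB then {Suc (2 * Suc i)} else {})"
    proof (intro equalityI subsetI)
      fix y
      assume "y \<in> ?L"
      then show "y \<in> {2 * Suc i} \<union> (if w ! i = LB then {Suc (2 * Suc i)} else {})"
        by (cases "odd y") (auto simp: level_elems_def elim!: evenE oddE)
    qed (use step.hyps in \<open>auto simp: level_elems_def split: if_splits\<close>)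
    then show ?thesis
      by (cases "w ! i") (simp_all add: distrib_right mult_2)
  qed
  finally show ?case
    using step.hyps by (cases "w ! i") (simp_all add: algebra_simps flip: Cons_nth_drop_Suc)
qed

lemma poset_rank_level_poset: "1 \<le> poset_rank (level_poset w)"
  unfolding poset_rank_pos_iff[OF graded_level_poset(1)] by (simp add: graded_level_poset)

lemma ab_index_level_poset: "ab_index (level_poset w) = (aab_prod w :: 'k::field ab_poly)"
proof -
  let ?P = "level_poset w"
  define c :: "nat \<Rightarrow> 'k ab_poly"
    where "c = (\<lambda>x. if x = 2 * Suc (length w) then 1 else var_b * aab_prod (drop (x div 2) w))"
  note P = graded_level_poset
  have sum: "(\<Sum>y\<in>aboveS ?P x. e_poly ^ (rank ?P y - rank ?P x - 1) * c y) = aab_prod (drop (x div 2) w)"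
    if "x \<in> level_elems w" "x \<noteq> top_of ?P" for x
  proof -
    have "x div 2 \<le> length w"
      using that level_elems_top[of x w] by (auto simp: P level_elems_def)
    moreover have "aboveS ?P x = {y. y \<in> level_elems w \<and> x div 2 < y div 2}"
      using that by (auto simp: aboveS_def level_poset_def)
    ultimately show ?thesis
      using aab_prod_level_sum[of "x div 2" w] that by (simp add: c_def P)
  qed
  have up: "up_sum ?P x = c x" if "x \<in> level_elems w" for x
  proof (rule up_sum_unique[OF P(1), where U = "level_elems w"])
    show "c x = var_b * (\<Sum>y\<in>aboveS ?P x. e_poly ^ (rank ?P y - rank ?P x - 1) * c y)"
      if "x \<in> level_elems w" "x \<noteq> top_of ?P" for x
      unfolding sum[OF that] using that by (simp add: c_def P)
  qed (use that in \<open>auto simp: Field_level_poset P c_def\<close>, auto simp: level_poset_def)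
  have 0: "0 \<in> level_elems w"
    using even_level_elem[of 0 w] by simp
  have "ab_index ?P = interval_index ?P 0"
    using ab_index_eq[OF P(1) poset_rank_level_poset] by (simp add: P)
  also have "\<dots> = (\<Sum>y\<in>aboveS ?P 0. e_poly ^ (rank ?P y - rank ?P 0 - 1) * c y)"
  proof -
    have "up_sum ?P y = c y" if "y \<in> aboveS ?P 0" for y
      using that by (intro up) (auto simp: level_poset_def)
    then show ?thesis
      unfolding interval_index_def by (intro sum.cong refl) simp
  qed
  also have "\<dots> = aab_prod w"
    using sum[OF 0] by (simp add: P)
  finally show ?thesis .
qed

text \<open>
  The ab-indices span: \<open>b = (a + b) - a\<close> with coefficients \<open>1\<close> and \<open>-1\<close>, so this holds in every characteristic.
\<close>

lemma ab_index_induct [case_names zero add scale ab_index]: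
  fixes u :: "'k::field ab_poly"
  assumes "P 0" "\<And>u v. P u \<Longrightarrow> P v \<Longrightarrow> P (u + v)" "\<And>c u. P u \<Longrightarrow> P (scale c u)"
    and gen: "\<And>Q :: nat rel. graded_poset Q \<Longrightarrow> 1 \<le> poset_rank Q \<Longrightarrow> P (ab_index Q)"
  shows "P u"
proof (rule product_induct[where P = P, OF assms(1,2,3), where ?p = var_a and ?q = "var_a + var_b"
      and ?a1.0 = 1 and ?a2.0 = 0 and ?b1.0 = "-1" and ?b2.0 = 1])
  show "P (aab_prod w)" for w
    using gen[OF graded_level_poset(1) poset_rank_level_poset, of w] by (simp add: ab_index_level_poset)
  have "scale (- 1) var_a = (- var_a :: 'k ab_poly)"
    by (rule poly_mapping_eqI) simp
  then show "var_b = scale (- 1) var_a + scale 1 (var_a + var_b :: 'k ab_poly)"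
    by simp
qed simp_all

section \<open>The diamond operator exists and is unique\<close>

lemma diamond_op_eq_dia: "diamond_op = (dia :: 'k::field ab_poly \<Rightarrow> _)"
  unfolding diamond_op_def
proof (rule the_equality)
  show "is_diamond_operator (dia :: 'k ab_poly \<Rightarrow> _)"
    by (auto simp: is_diamond_operator_def bilinear_dia ab_index_diamond_prod)
next
  fix N :: "'k ab_poly \<Rightarrow> 'k ab_poly \<Rightarrow> 'k ab_poly"
  assume "is_diamond_operator N"
  then have N: "lin (N u)" "lin (\<lambda>u. N u v)"
    and idx: "graded_poset P \<Longrightarrow> 1 \<le> poset_rank P \<Longrightarrow> graded_poset Q \<Longrightarrow> 1 \<le> poset_rank Q \<Longrightarrow>
        N (ab_index P) (ab_index Q) = dia (ab_index P) (ab_index Q)" for u v and P Q :: "nat rel"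
    by (auto simp: is_diamond_operator_def bilinear_op_iff ab_index_diamond_prod)
  have "N u v = dia u v" for u v
  proof (induction v rule: ab_index_induct)
    case (ab_index Q)
    show ?case
      by (induction u rule: ab_index_induct)
        (simp_all add: lin_zero[OF N(2)] lin_add[OF N(2)] lin_scale[OF N(2)]
          dia_zero dia_add dia_scale idx ab_index[simplified])
  qed (simp_all add: lin_zero[OF N(1)] lin_add[OF N(1)] lin_scale[OF N(1)]
      dia_zero dia_add dia_scale)
  then show "N = dia"
    by (intro ext)
qed

text \<open>
  The polynomial \<open>mix (ab_index P) (ab_index Q)\<close> is the ab-index of the Cartesian product, so by the
  spanning property a character is the same thing as a multiplicative functional for \<^const>\<open>mix\<close>.
\<close>

context
  fixes G :: "'k::field ab_poly \<Rightarrow> 'k"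
  assumes G: "ab_character G"
begin

lemma character_add: "G (u + v) = G u + G v"
  and character_scale: "G (scale c u) = c * G u"
  using G by (auto simp: ab_character_def Vector_Spaces.linear_iff)

lemma character_zero: "G 0 = 0"
  using character_scale[of 0 0] by simp

lemma character_mix: "G (mix u v) = G u * G v"
proof (induction v rule: ab_index_induct)
  case (ab_index Q)
  show ?case
  proof (induction u rule: ab_index_induct)
    case (ab_index P)
    then show ?case
      using G \<open>graded_poset Q\<close> \<open>1 \<le> poset_rank Q\<close>
      by (auto simp: ab_character_def simp flip: ab_index_poset_prod)
  qed (simp_all add: lin_zero[OF lin_mix(1)[OF lin_intros(2)]] lin_add[OF lin_mix(1)[OF lin_intros(2)]]
      lin_scale[OF lin_mix(1)[OF lin_intros(2)]] character_zero character_add character_scale distrib_right)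
qed (simp_all add: lin_zero[OF lin_mix(2)[OF lin_intros(2)]] lin_add[OF lin_mix(2)[OF lin_intros(2)]]
      lin_scale[OF lin_mix(2)[OF lin_intros(2)]] character_zero character_add character_scale distrib_left)

end

section \<open>Characters and chain maps of the first kind\<close>

definition homog :: "nat \<Rightarrow> 'k::field ab_poly \<Rightarrow> bool" where
  "homog n u \<longleftrightarrow> (\<forall>w\<in>Poly_Mapping.keys u. length (letters w) = n)"

lemma homog_add: "homog n u \<Longrightarrow> homog n v \<Longrightarrow> homog n (u + v)"
  and homog_diff: "homog n u \<Longrightarrow> homog n v \<Longrightarrow> homog n (u - v)"
  by (auto simp: homog_def in_keys_iff lookup_add lookup_minus)

lemma homog_mult: "homog m u \<Longrightarrow> homog n v \<Longrightarrow> homog (m + n) (u * v)"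
  using keys_mult[of u v] by (fastforce simp: homog_def plus_word_def)

lemma homog_monom: "homog (length w) (monom w)"
  by (simp add: homog_def monom_def)

lemma homog_vars: "homog 1 var_a" "homog 1 var_b"
  by (simp_all add: homog_def var_a_def var_b_def)

lemma homog_e_poly: "homog 1 e_poly"
  by (intro homog_diff homog_vars)

lemma homog_dia_word: "homog (length x + length y) (dia_word x y :: 'k::field ab_poly)"
proof (induction x y rule: dia_word.induct)
  case (5 x y)
  have "homog (Suc (length x + length y)) (dia_word x (LB # y) + dia_word (LB # x) y + e_poly * dia_word x y :: 'k ab_poly)"
    using 5 homog_mult[OF homog_e_poly] by (intro homog_add) fastforce+
  then show ?case
    using homog_mult[OF homog_vars(2)] by fastforce
next
  case (2 x y)
  then show ?case using homog_mult[OF homog_e_poly] by (fastforce intro: homog_add)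
next
  case (4 x y)
  then show ?case using homog_mult[OF homog_e_poly] by (fastforce intro: homog_add)
next
  case (3 x)
  show ?case using homog_monom[of "LB # x"] by simp
qed (simp add: homog_monom)

lemma homog_mix: "homog (Suc (length x + length y)) (mix (monom x) (monom y) :: 'k::field ab_poly)"
  using homog_dia_word[of x "LB # y"] homog_dia_word[of "LB # x" y]
    homog_mult[OF homog_e_poly homog_dia_word[of x y]]
  by (auto simp: mix_def intro!: homog_add simp flip: monom_Cons)

lemma lin_hat: "lin (hat F)"
  by (simp add: hat_def lin_lin_ext)

lemma hat_monom: "hat F (monom w) = scale (F (monom w)) (e_poly ^ length w)"
  by (simp add: hat_def monom_def)

lemma pulls_out_hat: "pulls_out (hat F u)"
proof (induction u rule: monom_induct)
  case zero
  show ?case by (simp add: lin_zero[OF lin_hat] pulls_out_def dia_zero)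
next
  case (add u v)
  then show ?case by (simp add: lin_add[OF lin_hat] pulls_out_def dia_add distrib_right)
next
  case (scale c u)
  then show ?case by (simp add: lin_scale[OF lin_hat] pulls_out_def dia_scale)
next
  case (monom w)
  show ?case by (simp only: hat_monom pulls_out_scale_e_power)
qed

context
  fixes G :: "'k::field ab_poly \<Rightarrow> 'k"
  assumes G: "ab_character G"
begin

lemma hat_homog:
  assumes "homog n u"
  shows "hat G u = scale (G u) (e_poly ^ n)"
proof -
  have sum: "G (\<Sum>i\<in>A. x i) = (\<Sum>i\<in>A. G (x i))" for A and x :: "'x \<Rightarrow> _"
    by (induction A rule: infinite_finite_induct) (simp_all add: character_zero character_add G)
  have "u = lin_ext (\<lambda>w. Poly_Mapping.single w 1) u"
    by (induction u rule: single_induct)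
      (simp_all add: lin_zero[OF lin_lin_ext] lin_add[OF lin_lin_ext] lin_scale[OF lin_lin_ext])
  then have "G u = G (lin_ext (\<lambda>w. Poly_Mapping.single w 1) u)"
    by (rule arg_cong)
  then have "G u = (\<Sum>w\<in>Poly_Mapping.keys u. Poly_Mapping.lookup u w * G (Poly_Mapping.single w 1))"
    unfolding lin_ext_def sum character_scale[OF G] .
  moreover have "hat G u = (\<Sum>w\<in>Poly_Mapping.keys u.
      scale (Poly_Mapping.lookup u w * G (Poly_Mapping.single w 1)) (e_poly ^ n))"
    using assms unfolding hat_def lin_ext_def homog_def by (intro sum.cong) simp_all
  moreover have "(\<Sum>w\<in>A. scale (c w) p) = scale (\<Sum>w\<in>A. c w) p" for A c and p :: "'k ab_poly"
    by (induction A rule: infinite_finite_induct) (simp_all add: scale_add_left)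
  ultimately show ?thesis by simp
qed

text \<open>
  Taking the mixture raises the degree by one, which is the origin of the factor \<open>e\<close>; on homogeneous
  polynomials \<open>hat G\<close> sees the degree and the value of \<open>G\<close> only.
\<close>

lemma hat_mix: "hat G (mix u v) = e_poly * (hat G u * hat G v)"
proof (rule bilinear_eq_on_monom[of "\<lambda>u v. hat G (mix u v)" "\<lambda>u v. e_poly * (hat G u * hat G v)"])
  show "lin (\<lambda>u. hat G (mix u v))" "lin (\<lambda>v. hat G (mix u v))" for u v
    by (rule lin_compose[OF lin_hat], intro lin_mix lin_intros)+
  show "lin (\<lambda>u. e_poly * (hat G u * hat G v))" "lin (\<lambda>v. e_poly * (hat G u * hat G v))" for u v
    by (intro lin_mult lin_hat)+
  show "hat G (mix (monom x) (monom y)) = e_poly * (hat G (monom x) * hat G (monom y))" for x y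
    by (simp add: hat_homog[OF homog_mix] character_mix[OF G] hat_monom power_add mult.assoc mult.commute)
qed

end

lemma coact_monom:
  assumes "bilinear_op B"
  shows "coact B (monom w) = B (monom w) 1
    + (\<Sum>i<length w. B (monom (take i w)) (var_b * monom (drop (Suc i) w)))"
  using assms
proof (induction w arbitrary: B)
  case Nil
  show ?case by simp
next
  case (Cons l w)
  have "bilinear_op (\<lambda>x. B (monom [l] * x))"
    by (rule bilinear_op_compose[where g = "\<lambda>y. y", OF Cons.prems]) (intro lin_rules)+
  from Cons.IH[OF this] show ?case
    by (simp add: coact_monom_Cons sum.lessThan_Suc_shift del: sum.lessThan_Suc flip: monom_append)
qed

subsection \<open>Unfolding the iterated coproduct\<close>

lemma kappa_word: "kappa (monom (LA # w)) = e_poly * kappa (monom w)" "kappa (monom (LB # w)) = 0"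
  unfolding kappa_def hat_monom by (simp_all add: alg_map_A_def monom_def)

lemma kappa_one: "kappa 1 = 1"
  using hat_monom[of alg_map_A "[]"] by (simp add: kappa_def alg_map_A_def lookup_one zero_word_def)

lemma lin_coproduct_pow: "lin (coproduct_pow k)"
proof -
  consider "k = 0" | "k = Suc 0" | j where "k = Suc (Suc j)"
    by (metis not0_implies_Suc)
  then show ?thesis
  proof cases
    case 3
    then show ?thesis
      by (intro linI) (simp_all add: coproduct_def lin_add[OF lin_lin_ext] lin_scale[OF lin_lin_ext])
  qed (auto intro!: linI simp: lin_add[OF lin_lin_ext] lin_scale[OF lin_lin_ext])
qed

lemma coproduct_pow_step:
  "coproduct_pow (Suc (Suc k)) (monom w) = (\<Sum>i<length w.
     Poly_Mapping.single (Word [Word (take i w)]) 1 * coproduct_pow (Suc k) (monom (drop (Suc i) w)))"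
  by (simp add: coproduct_def monom_def lin_sum[OF lin_lin_ext])

text \<open>
  Each application of the coproduct removes a letter. Thus the sum that defines the chain map may be
  taken over \<open>1 \<le> k \<le> K\<close> for any sufficiently large \<open>K\<close>, and it is linear although its range of
  summation depends on the argument.
\<close>

lemma coproduct_pow_vanishes: "Suc (length w) < k \<Longrightarrow> coproduct_pow k (monom w) = (0 :: 'k::field ab_tensor)"
proof (induction k arbitrary: w rule: less_induct)
  case (less k)
  obtain j where k: "k = Suc (Suc j)"
    using less.prems that[of "k - 2"] by simp
  have "coproduct_pow (Suc j) (monom (drop (Suc i) w)) = (0 :: 'k ab_tensor)" if "i < length w" for i
    by (rule less.IH) (use that less.prems k in auto)
  then show ?case
    unfolding k coproduct_pow_step by simp
qed

lemma chain_map_first_eq: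
  assumes "\<And>k. K < k \<Longrightarrow> coproduct_pow k u = 0"
  shows "chain_map_first G u = (\<Sum>k=1..K. chain_map_term G (coproduct_pow k u))"
proof -
  have "chain_map_term G 0 = 0"
    by (simp add: chain_map_term_def lin_zero[OF lin_lin_ext])
  moreover have "k \<le> K" if "coproduct_pow k u \<noteq> 0" for k
    using assms[of k] that by (cases "K < k") auto
  ultimately show ?thesis
    unfolding chain_map_first_def by (intro sum.mono_neutral_left) auto
qed

lemma coproduct_pow_eventually_0: "\<exists>K. \<forall>k>K. coproduct_pow k u = 0"
proof (induction u rule: monom_induct)
  case (add u v)
  then obtain K L where "\<forall>k>K. coproduct_pow k u = 0" "\<forall>k>L. coproduct_pow k v = 0" by blast
  then have "\<forall>k>max K L. coproduct_pow k (u + v) = 0"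
    by (simp add: lin_add[OF lin_coproduct_pow])
  then show ?case by blast
next
  case (monom w)
  then show ?case using coproduct_pow_vanishes by blast
next
  case (scale c u)
  then obtain K where "\<forall>k>K. coproduct_pow k u = 0" by blast
  then have "\<forall>k>K. coproduct_pow k (scale c u) = 0"
    by (simp add: lin_scale[OF lin_coproduct_pow])
  then show ?case by blast
qed (simp add: lin_zero[OF lin_coproduct_pow])

lemma lin_chain_map_term: "lin (chain_map_term G)"
  by (simp add: chain_map_term_def lin_lin_ext)

lemma lin_chain_map_first: "lin (chain_map_first G)"
proof (rule linI)
  fix u v :: "'a ab_poly" and c
  obtain K L where KL: "\<forall>k>K. coproduct_pow k u = 0" "\<forall>k>L. coproduct_pow k v = 0"
    using coproduct_pow_eventually_0 by meson
  let ?M = "max K L"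
  have "chain_map_first G x = (\<Sum>k=1..?M. chain_map_term G (coproduct_pow k x))"
    if "x \<in> {u, v, u + v, scale c u}" for x
    using that KL by (intro chain_map_first_eq)
      (auto simp: lin_add[OF lin_coproduct_pow] lin_scale[OF lin_coproduct_pow])
  then show "chain_map_first G (u + v) = chain_map_first G u + chain_map_first G v"
    "chain_map_first G (scale c u) = scale c (chain_map_first G u)"
    by (simp_all add: lin_add[OF lin_coproduct_pow] lin_scale[OF lin_coproduct_pow]
        lin_add[OF lin_chain_map_term] lin_scale[OF lin_chain_map_term] sum.distrib scale_sum)
qed

text \<open>
  Like the summands of the chain map, but with \<open>b hat G\<close> in place of \<open>kappa\<close> for the first factor too.
\<close>

definition tail_term :: "('k::field ab_poly \<Rightarrow> 'k) \<Rightarrow> 'k ab_tensor \<Rightarrow> 'k ab_poly" where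
  "tail_term G = lin_ext (\<lambda>ws.
     prod_list (map (\<lambda>w. var_b * hat G (Poly_Mapping.single w 1)) (letters ws)))"

lemma lin_tail_term: "lin (tail_term G)"
  by (simp add: tail_term_def lin_lin_ext)

lemma tensor_term_Cons:
  "chain_map_term G (Poly_Mapping.single (Word [Word x]) 1 * t) = kappa (monom x) * tail_term G t"
  "tail_term G (Poly_Mapping.single (Word [Word x]) 1 * t) = var_b * hat G (monom x) * tail_term G t"
  by (induction t rule: single_induct)
    (simp_all add: lin_zero[OF lin_chain_map_term] lin_add[OF lin_chain_map_term] lin_scale[OF lin_chain_map_term]
      lin_zero[OF lin_tail_term] lin_add[OF lin_tail_term] lin_scale[OF lin_tail_term] distrib_left,
     simp_all add: chain_map_term_def tail_term_def mult_single plus_word_def monom_def)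

definition tail_map :: "('k::field ab_poly \<Rightarrow> 'k) \<Rightarrow> ab_letter list \<Rightarrow> 'k ab_poly" where
  "tail_map G w = (\<Sum>k=1..Suc (length w). tail_term G (coproduct_pow k (monom w)))"

lemma tail_map_eq:
  assumes "Suc (length w) \<le> K"
  shows "tail_map G w = (\<Sum>k=1..K. tail_term G (coproduct_pow k (monom w)))"
  unfolding tail_map_def using assms
  by (intro sum.mono_neutral_left) (auto simp: coproduct_pow_vanishes lin_zero[OF lin_tail_term])

text \<open>
  Once the first tensor factor of the iterated coproduct is split off, what remains is the same kind
  of sum for the suffix, shifted by one in \<open>k\<close>. The lemma serves the chain map (\<open>p\<close> is
  \<open>kappa\<close>) and its tails (\<open>p\<close> is \<open>b hat G\<close>).
\<close>

lemma sum_coproduct_pow: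
  assumes f: "lin f" and f_Cons: "\<And>x t. f (Poly_Mapping.single (Word [Word x]) 1 * t) = p x * tail_term G t"
  shows "(\<Sum>k=1..Suc (length w). f (coproduct_pow k (monom w)))
    = f (Poly_Mapping.single (Word [Word w]) 1) + (\<Sum>i<length w. p (take i w) * tail_map G (drop (Suc i) w))"
proof -
  have "(\<Sum>k=1..Suc (length w). f (coproduct_pow k (monom w)))
      = f (coproduct_pow 1 (monom w)) + (\<Sum>k=1..length w. f (coproduct_pow (Suc k) (monom w)))"
    by (subst sum.atLeast_Suc_atMost) (simp, simp only: sum.shift_bounds_cl_Suc_ivl)
  also have "(\<Sum>k=1..length w. f (coproduct_pow (Suc k) (monom w)))
      = (\<Sum>k=1..length w. \<Sum>i<length w. p (take i w) * tail_term G (coproduct_pow k (monom (drop (Suc i) w))))"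
  proof (intro sum.cong refl)
    fix k
    assume "k \<in> {1..length w}"
    then obtain j where "k = Suc j" by (cases k) auto
    then show "f (coproduct_pow (Suc k) (monom w))
        = (\<Sum>i<length w. p (take i w) * tail_term G (coproduct_pow k (monom (drop (Suc i) w))))"
      by (simp only: coproduct_pow_step lin_sum[OF f] f_Cons)
  qed
  also have "\<dots> = (\<Sum>i<length w. p (take i w) * tail_map G (drop (Suc i) w))"
    by (subst sum.swap) (simp add: tail_map_eq[of _ "length w"] sum_distrib_left)
  finally show ?thesis
    by (simp add: monom_def)
qed

lemma chain_map_first_monom:
  "chain_map_first G (monom w) = kappa (monom w)
    + (\<Sum>i<length w. kappa (monom (take i w)) * tail_map G (drop (Suc i) w))"
proof -
  have "chain_map_first G (monom w) = (\<Sum>k=1..Suc (length w). chain_map_term G (coproduct_pow k (monom w)))"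
    by (rule chain_map_first_eq) (rule coproduct_pow_vanishes)
  then show ?thesis
    unfolding sum_coproduct_pow[OF lin_chain_map_term tensor_term_Cons(1)]
    using tensor_term_Cons(1)[of G w 1] by (simp add: chain_map_term_def monom_def)
qed

lemma tail_map_rec:
  "tail_map G w = var_b * hat G (monom w)
    + (\<Sum>i<length w. var_b * hat G (monom (take i w)) * tail_map G (drop (Suc i) w))"
  unfolding tail_map_def[of G w] sum_coproduct_pow[OF lin_tail_term tensor_term_Cons(2)]
  by (simp add: tail_term_def monom_def)

text \<open>
  As \<open>kappa\<close> kills every word that contains \<open>b\<close>, a leading \<open>b\<close> has to be the letter that is removed by the first
  split. A leading \<open>a\<close> either is removed, or \<open>kappa\<close> turns it into a factor \<open>e\<close>.
\<close>

lemma chain_map_first_Cons: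
  "chain_map_first G (monom (LA # w)) = e_poly * chain_map_first G (monom w) + tail_map G w"
  "chain_map_first G (monom (LB # w)) = tail_map G w"
  unfolding chain_map_first_monom
  by (simp_all add: sum.lessThan_Suc_shift kappa_word kappa_one algebra_simps sum_distrib_left
      del: sum.lessThan_Suc)

lemma chain_map_first_one: "chain_map_first G 1 = 1"
  using chain_map_first_monom[of G "[]"] kappa_one by simp

lemma chain_map_first_e: "chain_map_first G (e_poly * u) = e_poly * chain_map_first G u"
proof (rule lin_eq_on_monom[where f = "\<lambda>u. chain_map_first G (e_poly * u)"])
  show "lin (\<lambda>u. chain_map_first G (e_poly * u))"
    by (rule lin_compose[OF lin_chain_map_first]) (intro lin_rules)
  show "lin (\<lambda>u. e_poly * chain_map_first G u)"
    by (intro lin_mult lin_chain_map_first)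
  show "chain_map_first G (e_poly * monom w) = e_poly * chain_map_first G (monom w)" for w
    by (simp only: e_times_monom lin_diff[OF lin_chain_map_first] chain_map_first_Cons add_diff_cancel_right')
qed

lemma chain_map_first_b:
  "chain_map_first G (var_b * u) = var_b * coact (\<lambda>x y. hat G x * chain_map_first G y) u"
proof (rule lin_eq_on_monom[where f = "\<lambda>u. chain_map_first G (var_b * u)"])
  show "lin (\<lambda>u. chain_map_first G (var_b * u))"
    by (rule lin_compose[OF lin_chain_map_first]) (intro lin_rules)
  show "lin (\<lambda>u. var_b * coact (\<lambda>x y. hat G x * chain_map_first G y) u)"
    by (intro lin_mult lin_coact)
  have bil: "bilinear_op (\<lambda>x y. hat G x * chain_map_first G y)"
    unfolding bilinear_op_iff by (intro conjI allI lin_mult lin_hat lin_chain_map_first)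
  show "chain_map_first G (var_b * monom w)
      = var_b * coact (\<lambda>x y. hat G x * chain_map_first G y) (monom w)" for w
    unfolding coact_monom[OF bil] monom_Cons(2)[symmetric] chain_map_first_Cons(2)
    by (subst tail_map_rec) (simp add: chain_map_first_one distrib_left sum_distrib_left mult.assoc)
qed

section \<open>The chain map is multiplicative\<close>

theorem theorem13p1:
  fixes G :: "'k::field ab_poly \<Rightarrow> 'k" and u v :: "'k ab_poly"
  assumes "ab_character G"
  shows "chain_map_first G (diamond_op u v) = diamond_op (chain_map_first G u) (chain_map_first G v)"
  unfolding diamond_op_eq_dia
  by (rule diamond_hom_from_coaction[where g = "chain_map_first G" and \<gamma> = "hat G"])
    (intro lin_chain_map_first lin_hat chain_map_first_one chain_map_first_e chain_map_first_b
      hat_mix[OF assms] pulls_out_hat)+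

end
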